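(* Let $\mathbb{C}\mathrm{H}(n)=G/H$ with $G=F_rN$ be a non-symmetric homogeneous description and $\tilde\nabla$ the canonical connection of a reductive decomposition $\mathfrak{g}=\mathfrak{h}+\mathfrak{m}$. Then the torsion form $\tilde T$ of $\tilde\nabla$ is given, for $X,Y\in\mathfrak{n}_1$, by $$\tilde T_{\tilde A_0}\tilde X=-\widetilde{fX},\qquad \tilde T_{\tilde A_0}\tilde N_2=-2\tilde N_2,\qquad \tilde T_{\tilde N_2}\tilde X=-[\varphi(N_2),X],$$ $$\tilde T_{\tilde X}\tilde Y=-2\,\omega_0(X,Y)\,\tilde N_2-[\varphi(X),\tilde Y]-[\tilde X,\varphi(Y)],$$ where $f=\mathrm{Id}+\mathrm{ad}_{H_{r0}}:\mathfrak{n}_1\to\mathfrak{n}_1$ and $H_{r0}=H_r+\varphi(A_0)$.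
   Context: Fix $n\ge1$. $\mathrm{SU}(n,1)$ is the group of determinant-one complex $(n+1)\times(n+1)$ matrices preserving the Hermitian form $\hat h(X,Y)=\overline{Y_1}X_1+\dots+\overline{Y_{n-1}}X_{n-1}+\overline{Y_{n+1}}X_n+\overline{Y_n}X_{n+1}$; $\mathbb{C}\mathrm{H}(n)$ is the space of $\hat h$-negative lines with its invariant Kähler metric, with base point $o$ the line spanned by $(0,\dots,0,1,-1)$. Matrices are in blocks of sizes $n-1,1,1$. Put $\mathfrak{s}(\mathfrak{u}(n-1)+\mathfrak{u}(1))=\{\mathrm{diag}(B,ic,ic): B\in\mathfrak{u}(n-1),c\in\mathbb{R},\mathrm{tr}B+2ic=0\}$, with connected group $\mathrm{S}(\mathrm{U}(n-1)\mathrm{U}(1))$; $A_0=\mathrm{diag}(0,\dots,0,1,-1)$, $\mathfrak{a}=\mathbb{R}A_0$, $A=\exp\mathfrak{a}$; $\mathfrak{n}_1=\left\{\begin{pmatrix}0&0&v\\-v^*&0&0\\0&0&0\end{pmatrix}: v\in\mathbb{C}^{n-1}\right\}\cong\mathbb{C}^{n-1}$; $N_2=\begin{pmatrix}0&0&0\\0&0&i\\0&0&0\end{pmatrix}$, $\mathfrak{n}_2=\mathbb{R}N_2$, $\mathfrak{n}=\mathfrak{n}_1+\mathfrak{n}_2$, $N=\exp\mathfrak{n}$. For $X,Y\in\mathfrak{n}_1$ corresponding to $v,w\in\mathbb{C}^{n-1}$, $\omega_0(X,Y)=\mathrm{Im}(w^*v)$, so $[X,Y]=2\omega_0(X,Y)N_2$.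 Non-symmetric description: $G=F_rN$, where $F_r$ is a connected closed subgroup of $\mathrm{S}(\mathrm{U}(n-1)\mathrm{U}(1))A$ with non-trivial projection to $A$, and $H=F_r\cap \mathrm{S}(\mathrm{U}(n-1)\mathrm{U}(1))$; $\mathfrak{g},\mathfrak{h},\mathfrak{f}_r$ are the Lie algebras of $G,H,F_r$. Let $\mathfrak{a}_r$ be the orthogonal complement of $\mathfrak{h}$ in $\mathfrak{f}_r$ for $k(E,E')=\mathrm{Re}\,\mathrm{tr}(E^*E')$; it is one-dimensional, $\mathfrak{a}_r=\mathbb{R}A_r$ with $A_r=A_0+H_r$, $H_r\in\mathfrak{s}(\mathfrak{u}(n-1)+\mathfrak{u}(1))$. Put $\mathfrak{s}=\mathfrak{a}+\mathfrak{n}$, $\mathfrak{s}_r=\mathfrak{a}_r+\mathfrak{n}$, and let $\chi_r:\mathfrak{s}\to\mathfrak{s}_r$ be linear, the identity on $\mathfrak{n}$, with $\chi_r(A_0)=A_r$. Given a reductive decomposition $\mathfrak{g}=\mathfrak{h}+\mathfrak{m}$ ($\mathfrak{m}$ an $\mathrm{Ad}(H)$-invariant complement), $\mathfrak{m}$ is the graph of a unique $\mathfrak{h}$-equivariant linear map $\varphi_r:\mathfrak{s}_r\to\mathfrak{h}$; put $\varphi=\varphi_r\circ\chi_r:\mathfrak{s}\to\mathfrak{h}$ and $\tilde X=\chi_r(X)+\varphi(X)$, so $X\mapsto\tilde X$ is a linear isomorphism $\mathfrak{s}\to\mathfrak{m}\cong T_o\mathbb{C}\mathrm{H}(n)$.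 Brackets are taken in $\mathfrak{g}$. Convention: curvature $\tilde R$ and torsion $\tilde T$ of the canonical connection at $o$ are normalized by $[B,C]=\tilde R_{BC}-\tilde T_BC$ for $B,C\in\mathfrak{m}$, i.e. $\tilde R_{BC}=[B,C]_{\mathfrak{h}}$ and $\tilde T_BC=-[B,C]_{\mathfrak{m}}$. *)

theory Defs
  imports "HOL-Analysis.Analysis" "HOL-Algebra.Generated_Groups"
begin

(* The coordinates 1, ..., n+1 are the elements of a finite type 'k.  Two distinct indices p and q
   are singled out, playing the roles of the coordinates n and n+1; the remaining n-1 indices, in
   any order, form the first block.  Thus n = CARD('k) - 1, and the existence of p ~= q is exactly
   n >= 1 (for n = 1 the first block is empty).  In X $ i $ j, i is the row and j the column. *)

type_synonym 'k cmat = "complex^'k^'k"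

section \<open>Matrix groups\<close>

definition GL :: "('k::finite) cmat monoid" where
  "GL = \<lparr>carrier = {X. invertible X}, mult = (**), one = mat 1\<rparr>"

definition mexp :: "('k::finite) cmat \<Rightarrow> 'k cmat" where
  "mexp X = (\<Sum>k. (1 / fact k :: real) *\<^sub>R (((**) X ^^ k) (mat 1)))"

definition bracket :: "('k::finite) cmat \<Rightarrow> 'k cmat \<Rightarrow> 'k cmat" where
  "bracket X Y = X ** Y - Y ** X"

definition lie_algebra :: "('k::finite) cmat set \<Rightarrow> 'k cmat set" where
  "lie_algebra S = {X. \<forall>t::real. mexp (t *\<^sub>R X) \<in> S}"

(* The connected Lie group with Lie algebra L is the subgroup generated by exp L. *)
definition connected_group :: "('k::finite) cmat set \<Rightarrow> 'k cmat set" where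
  "connected_group L = generate GL (mexp ` L)"

section \<open>Complex hyperbolic space\<close>

definition hform :: "'k \<Rightarrow> 'k \<Rightarrow> complex^('k::finite) \<Rightarrow> complex^'k \<Rightarrow> complex" where
  "hform p q x y =
     (\<Sum>i\<in>-{p, q}. cnj (y $ i) * x $ i) + cnj (y $ q) * x $ p + cnj (y $ p) * x $ q"

definition SU_n1 :: "'k \<Rightarrow> 'k \<Rightarrow> ('k::finite) cmat set" where
  "SU_n1 p q = {g. det g = 1 \<and> (\<forall>x y. hform p q (g *v x) (g *v y) = hform p q x y)}"

definition cline :: "complex^('k::finite) \<Rightarrow> (complex^'k) set" where
  "cline x = range (\<lambda>c. c *s x)"

definition CH :: "'k \<Rightarrow> 'k \<Rightarrow> (complex^('k::finite)) set set" where
  "CH p q = {cline x | x. Re (hform p q x x) < 0}"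

definition base_point :: "'k \<Rightarrow> 'k \<Rightarrow> (complex^('k::finite)) set" where
  "base_point p q = cline (axis p 1 - axis q 1)"

(* CH(n) = G/H: the group G of isometries of CH(n) acts transitively, with isotropy group H at
   the base point. *)
definition homogeneous_description ::
    "'k \<Rightarrow> 'k \<Rightarrow> ('k::finite) cmat set \<Rightarrow> 'k cmat set \<Rightarrow> bool" where
  "homogeneous_description p q G H \<longleftrightarrow>
     subgroup G GL \<and> G \<subseteq> SU_n1 p q \<and>
     (\<forall>L\<in>CH p q. \<exists>g\<in>G. ((*v) g) ` base_point p q = L) \<and>
     H = {g\<in>G. ((*v) g) ` base_point p q = base_point p q}"

section \<open>The subalgebras of su(n,1) and their groups\<close>

(* diag(B, z, w); only the entries of B in the first block are used. *)
definition block_diag :: "'k \<Rightarrow> 'k \<Rightarrow> ('k::finite) cmat \<Rightarrow> complex \<Rightarrow> complex \<Rightarrow> 'k cmat" where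
  "block_diag p q B z w =
     (\<chi> i j. if i \<in> -{p, q} \<and> j \<in> -{p, q} then B $ i $ j
            else if i = p \<and> j = p then z
            else if i = q \<and> j = q then w
            else 0)"

definition k0_alg :: "'k \<Rightarrow> 'k \<Rightarrow> ('k::finite) cmat set" where
  "k0_alg p q = {block_diag p q B (\<i> * of_real c) (\<i> * of_real c) | B (c::real).
      (\<forall>i\<in>-{p, q}. \<forall>j\<in>-{p, q}. cnj (B $ j $ i) = - B $ i $ j) \<and>
      (\<Sum>i\<in>-{p, q}. B $ i $ i) + 2 * \<i> * of_real c = 0}"

definition K0_grp :: "'k \<Rightarrow> 'k \<Rightarrow> ('k::finite) cmat set" where
  "K0_grp p q = connected_group (k0_alg p q)"

definition A0 :: "'k \<Rightarrow> 'k \<Rightarrow> ('k::finite) cmat" where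
  "A0 p q = block_diag p q 0 1 (-1)"

definition A_grp :: "'k \<Rightarrow> 'k \<Rightarrow> ('k::finite) cmat set" where
  "A_grp p q = mexp ` span {A0 p q}"

(* Only the entries of v off p and q are used. *)
definition n1_elem :: "'k \<Rightarrow> 'k \<Rightarrow> complex^('k::finite) \<Rightarrow> 'k cmat" where
  "n1_elem p q v =
     (\<chi> i j. if i \<in> -{p, q} \<and> j = q then v $ i
            else if i = p \<and> j \<in> -{p, q} then - cnj (v $ j)
            else 0)"

definition n1_alg :: "'k \<Rightarrow> 'k \<Rightarrow> ('k::finite) cmat set" where
  "n1_alg p q = range (n1_elem p q)"

definition N2 :: "'k \<Rightarrow> 'k \<Rightarrow> ('k::finite) cmat" where
  "N2 p q = (\<chi> i j. if i = p \<and> j = q then \<i> else 0)"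

definition n_alg :: "'k \<Rightarrow> 'k \<Rightarrow> ('k::finite) cmat set" where
  "n_alg p q = {X + Z | X Z. X \<in> n1_alg p q \<and> Z \<in> span {N2 p q}}"

definition N_grp :: "'k \<Rightarrow> 'k \<Rightarrow> ('k::finite) cmat set" where
  "N_grp p q = mexp ` n_alg p q"

(* Im (w^* v) for X, Y corresponding to v, w: the vector v is the q-column of X. *)
definition omega0 :: "'k \<Rightarrow> 'k \<Rightarrow> ('k::finite) cmat \<Rightarrow> 'k cmat \<Rightarrow> real" where
  "omega0 p q X Y = Im (\<Sum>i\<in>-{p, q}. cnj (Y $ i $ q) * X $ i $ q)"

lemma omega0_n1_elem:
  "omega0 p q (n1_elem p q v) (n1_elem p q w) = Im (\<Sum>i\<in>-{p, q}. cnj (w $ i) * v $ i)"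
  unfolding omega0_def n1_elem_def by (auto intro!: arg_cong[of _ _ Im] sum.cong)

section \<open>Non-symmetric homogeneous descriptions\<close>

definition G_grp :: "'k \<Rightarrow> 'k \<Rightarrow> ('k::finite) cmat set \<Rightarrow> 'k cmat set" where
  "G_grp p q F = F <#>\<^bsub>GL\<^esub> N_grp p q"

definition H_grp :: "'k \<Rightarrow> 'k \<Rightarrow> ('k::finite) cmat set \<Rightarrow> 'k cmat set" where
  "H_grp p q F = F \<inter> K0_grp p q"

definition nonsymmetric_description :: "'k \<Rightarrow> 'k \<Rightarrow> ('k::finite) cmat set \<Rightarrow> bool" where
  "nonsymmetric_description p q F \<longleftrightarrow>
     subgroup F GL \<and>
     closedin (top_of_set (K0_grp p q <#>\<^bsub>GL\<^esub> A_grp p q)) F \<and>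
     connected F \<and>
     (\<exists>k\<in>K0_grp p q. \<exists>a\<in>A_grp p q. k ** a \<in> F \<and> a \<noteq> mat 1) \<and>
     homogeneous_description p q (G_grp p q F) (H_grp p q F)"

definition kform :: "('k::finite) cmat \<Rightarrow> 'k cmat \<Rightarrow> real" where
  "kform E E' = Re (trace ((\<chi> i j. cnj (E $ j $ i)) ** E'))"

definition a_r :: "'k \<Rightarrow> 'k \<Rightarrow> ('k::finite) cmat set \<Rightarrow> 'k cmat set" where
  "a_r p q F = {E \<in> lie_algebra F. \<forall>E'\<in>lie_algebra (H_grp p q F). kform E E' = 0}"

section \<open>Reductive decompositions and the torsion of the canonical connection\<close>

definition reductive_decomposition ::
    "('k::finite) cmat set \<Rightarrow> 'k cmat set \<Rightarrow> 'k cmat set \<Rightarrow> bool" where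
  "reductive_decomposition G H \<mm> \<longleftrightarrow>
     subspace \<mm> \<and>
     lie_algebra G = {E + M | E M. E \<in> lie_algebra H \<and> M \<in> \<mm>} \<and>
     lie_algebra H \<inter> \<mm> = {0} \<and>
     (\<forall>x\<in>H. \<forall>M\<in>\<mm>. x ** M ** matrix_inv x \<in> \<mm>)"

definition m_part :: "('k::finite) cmat set \<Rightarrow> 'k cmat set \<Rightarrow> 'k cmat \<Rightarrow> 'k cmat" where
  "m_part \<hh> \<mm> Z = (THE M. M \<in> \<mm> \<and> Z - M \<in> \<hh>)"

(* Torsion at o of the canonical connection, under the identification of \<mm> with the tangent
   space at o; the sign convention is [B,C] = R_BC - T_B C. *)
definition torsion :: "('k::finite) cmat set \<Rightarrow> 'k cmat set \<Rightarrow> 'k cmat \<Rightarrow> 'k cmat \<Rightarrow> 'k cmat" where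
  "torsion \<hh> \<mm> B C = - m_part \<hh> \<mm> (bracket B C)"

(* For X = t A0 + Z in a + n one has t = X $ p $ p, so this is the linear map fixing n pointwise
   and sending A0 to A0 + Hr; see the next lemma. *)
definition chi_r :: "'k \<Rightarrow> 'k \<Rightarrow> ('k::finite) cmat \<Rightarrow> 'k cmat \<Rightarrow> 'k cmat" where
  "chi_r p q Hr X = X + Re (X $ p $ p) *\<^sub>R Hr"

lemma chi_r_characterization:
  assumes "p \<noteq> q"
  shows "linear (chi_r p q Hr)"
    and "Z \<in> n_alg p q \<Longrightarrow> chi_r p q Hr Z = Z"
    and "chi_r p q Hr (A0 p q) = A0 p q + Hr"
proof -
  show "linear (chi_r p q Hr)"
    by (rule linearI) (simp_all add: chi_r_def algebra_simps)
  show "chi_r p q Hr (A0 p q) = A0 p q + Hr"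
    by (simp add: chi_r_def A0_def block_diag_def)
  show "chi_r p q Hr Z = Z" if "Z \<in> n_alg p q"
    using that assms
    by (auto simp: chi_r_def n_alg_def n1_alg_def n1_elem_def N2_def span_singleton)
qed

(* The map s_r -> h whose graph is \<mm>: since a_r + n is a complement of h in g = h + \<mm>, every X
   in s_r = a_r + n has exactly one E in h with X + E in \<mm>.  Its linearity and h-equivariance are
   consequences of the linearity and Ad(H)-invariance of \<mm>.  Values off s_r are irrelevant. *)
definition phi_r :: "('k::finite) cmat set \<Rightarrow> 'k cmat set \<Rightarrow> 'k cmat \<Rightarrow> 'k cmat" where
  "phi_r \<hh> \<mm> X = (THE E. E \<in> \<hh> \<and> X + E \<in> \<mm>)"

definition phi :: "'k \<Rightarrow> 'k \<Rightarrow> ('k::finite) cmat set \<Rightarrow> 'k cmat set \<Rightarrow> 'k cmat \<Rightarrow> 'k cmat \<Rightarrow> 'k cmat" where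
  "phi p q \<hh> \<mm> Hr X = phi_r \<hh> \<mm> (chi_r p q Hr X)"

definition tilde :: "'k \<Rightarrow> 'k \<Rightarrow> ('k::finite) cmat set \<Rightarrow> 'k cmat set \<Rightarrow> 'k cmat \<Rightarrow> 'k cmat \<Rightarrow> 'k cmat" where
  "tilde p q \<hh> \<mm> Hr X = chi_r p q Hr X + phi p q \<hh> \<mm> Hr X"

end

(* A0 acts on n1 and n2 with weights 1 and 2.  The isotropy algebra h lies in k0, so it centralizes
   A0 and N2 and normalizes n1, and [h, phi N2] lies in both h and m, hence vanishes.  Every torsion
   value is then the m-part of a bracket whose h-part is visible.

   Since h is given as the set of X with exp (tX) in H for all t, one must first know that it is a
   linear subspace.  For X, Y in h the Lie product formula writes exp (t(X + Y)) as a limit of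
   elements of H, and H is closed in K0; that exp (t(X + Y)) lies in K0 follows from h <= k0, which
   is read off by differentiating at t = 0 the conditions that exp (tX) commutes with N2 and its
   transpose, preserves the Hermitian form and has determinant one.  The ad-invariance of h and m
   also comes from differentiating the Ad-invariance at t = 0. *)

theory Submission
  imports Defs
begin

section \<open>Matrices as a Banach algebra\<close>

text \<open>The m-part of a bracket never has to be solved for. On n the map \<open>td\<close> is
  \<open>Z + \<phi> Z\<close>, and a bracket of an element of h with one of m stays in m; so a
  candidate in m can be assembled from values of \<open>td\<close> and such brackets, and what
  remains is to see that its difference from the full bracket lies in h. Two obstacles shape the
  rest. \<open>K0_grp\<close> is given by generators, and only k0 inside its Lie algebra is
  established; hence membership in it is used solely through commutation relations, which survive
  generation and force the shape diag(B, z, z). Skewness and trace zero come instead from F lying in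
  SU(n,1). Secondly, \<open>Hr\<close> enters only through \<open>A0 p q + Hr\<close> in the Lie
  algebra of F, so that it normalizes h has to be deduced from the action of that sum.\<close>

lemma matrix_mult_add_rdistrib: "(A + B) ** C = A ** C + B ** (C :: ('k::finite) cmat)"
  by (simp add: matrix_matrix_mult_def vec_eq_iff distrib_right sum.distrib)

lemma scaleR_matrix_mult_left: "(c *\<^sub>R A) ** B = c *\<^sub>R (A ** (B :: ('k::finite) cmat))"
  by (simp add: matrix_matrix_mult_def vec_eq_iff scaleR_sum_right)

lemma scaleR_matrix_mult_right: "A ** (c *\<^sub>R B) = c *\<^sub>R (A ** (B :: ('k::finite) cmat))"
  by (simp add: matrix_matrix_mult_def vec_eq_iff scaleR_sum_right)

lemma scaleR_matrix_vector_mult: "(c *\<^sub>R A) *v x = c *\<^sub>R ((A :: ('k::finite) cmat) *v x)"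
  by (simp add: matrix_vector_mult_def vec_eq_iff scaleR_sum_right)

lemma matrix_vector_mult_axis_nth: "((A :: ('k::finite) cmat) *v axis j 1) $ i = A $ i $ j"
  by (simp add: matrix_vector_mult_def axis_def if_distrib cong: if_cong)

lemma norm_axis_one: "norm (axis j (1::complex) :: complex^'k::finite) = 1"
  by (simp add: norm_vec_def axis_def L2_set_def if_distrib if_distribR cong: if_cong)

text \<open>A copy of the matrices carrying the operator norm, so that the library's exponential on
  Banach algebras applies; in the Euclidean norm of \<^typ>\<open>'k cmat\<close> the identity matrix does not
  have norm one.\<close>

typedef (overloaded) 'k opmat = "UNIV :: ('k::finite) cmat set"
  morphisms mat_of Opmat ..

setup_lifting type_definition_opmat

instantiation opmat :: (finite) real_vector
begin

lift_definition zero_opmat :: "'a opmat" is 0 .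
lift_definition plus_opmat :: "'a opmat \<Rightarrow> 'a opmat \<Rightarrow> 'a opmat" is "(+)" .
lift_definition minus_opmat :: "'a opmat \<Rightarrow> 'a opmat \<Rightarrow> 'a opmat" is "(-)" .
lift_definition uminus_opmat :: "'a opmat \<Rightarrow> 'a opmat" is "uminus" .
lift_definition scaleR_opmat :: "real \<Rightarrow> 'a opmat \<Rightarrow> 'a opmat" is "(*\<^sub>R)" .

instance
  by standard (transfer; simp add: algebra_simps)+

end

instantiation opmat :: (finite) real_algebra_1
begin

lift_definition one_opmat :: "'a opmat" is "mat 1" .
lift_definition times_opmat :: "'a opmat \<Rightarrow> 'a opmat \<Rightarrow> 'a opmat" is "(**)" .

instance
proof
  show "(0::'a opmat) \<noteq> 1"
    by transfer (simp add: mat_def vec_eq_iff)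
qed (transfer; simp add: matrix_mul_assoc matrix_add_ldistrib matrix_mult_add_rdistrib
      scaleR_matrix_mult_left scaleR_matrix_mult_right)+

end

text \<open>The action on column vectors, an injective homomorphism into the bounded operators.
  Pulling the norm back along it turns submultiplicativity and \<open>norm 1 = 1\<close> into facts
  about composition of operators.\<close>

lift_definition op_of :: "'k::finite opmat \<Rightarrow> (complex^'k) \<Rightarrow>\<^sub>L (complex^'k)" is "\<lambda>A. (*v) A"
  by simp

lemma op_of_apply: "blinfun_apply (op_of A) x = mat_of A *v x"
  by transfer simp

lemma op_of_simps:
  "op_of 0 = 0" "op_of (A + B) = op_of A + op_of B" "op_of (A - B) = op_of A - op_of B"
  "op_of (c *\<^sub>R A) = c *\<^sub>R op_of A" "op_of 1 = id_blinfun"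
  "op_of (A * B) = op_of A o\<^sub>L op_of B"
  by (auto intro!: blinfun_eqI
      simp: op_of_apply blinfun.bilinear_simps zero_opmat.rep_eq plus_opmat.rep_eq minus_opmat.rep_eq
        scaleR_opmat.rep_eq one_opmat.rep_eq times_opmat.rep_eq matrix_vector_mult_add_rdistrib
        matrix_vector_mult_diff_rdistrib matrix_vector_mul_assoc scaleR_matrix_vector_mult)

lemma op_of_inject: "op_of A = op_of B \<longleftrightarrow> A = B"
  by (metis mat_of_inject matrix_eq op_of_apply)

instantiation opmat :: (finite) real_normed_algebra_1
begin

definition norm_opmat :: "'a opmat \<Rightarrow> real" where "norm_opmat A = norm (op_of A)"
definition dist_opmat :: "'a opmat \<Rightarrow> 'a opmat \<Rightarrow> real" where "dist_opmat A B = norm (A - B)"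
definition sgn_opmat :: "'a opmat \<Rightarrow> 'a opmat" where "sgn_opmat A = inverse (norm A) *\<^sub>R A"
definition uniformity_opmat :: "('a opmat \<times> 'a opmat) filter" where
  "uniformity_opmat = (INF e\<in>{0<..}. principal {(x, y). dist x y < e})"
definition open_opmat :: "'a opmat set \<Rightarrow> bool" where
  "open_opmat S = (\<forall>x\<in>S. \<forall>\<^sub>F (x', y) in uniformity. x' = x \<longrightarrow> y \<in> S)"

instance
proof
  fix A B :: "'a opmat" and c :: real
  show "norm A = 0 \<longleftrightarrow> A = 0"
    by (metis norm_eq_zero norm_opmat_def op_of_inject op_of_simps(1))
  show "norm (A + B) \<le> norm A + norm B"
    by (simp add: norm_opmat_def op_of_simps norm_triangle_ineq)
  show "norm (c *\<^sub>R A) = \<bar>c\<bar> * norm A"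
    by (simp add: norm_opmat_def op_of_simps)
  show "norm (A * B) \<le> norm A * norm B"
    by (simp add: norm_opmat_def op_of_simps norm_blinfun_compose)
  show "norm (1 :: 'a opmat) = 1"
    by (simp add: norm_opmat_def op_of_simps)
qed (simp_all add: dist_opmat_def sgn_opmat_def uniformity_opmat_def open_opmat_def)

end

text \<open>A linear map out of a finite-dimensional space is automatically bounded. Together with
  the bound for \<open>mat_of\<close> this makes the two norms equivalent, so limits, sums and
  derivatives pass between the two types.\<close>

lemma bounded_linear_Opmat: "bounded_linear (Opmat :: ('k::finite) cmat \<Rightarrow> _)"
proof -
  have "linear (\<lambda>A::'k cmat. op_of (Opmat A))"
    by (rule linearI) (auto intro!: blinfun_eqI simp: op_of_apply blinfun.bilinear_simps Opmat_inverse
      matrix_vector_mult_add_rdistrib scaleR_matrix_vector_mult)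
  then interpret bounded_linear "\<lambda>A::'k cmat. op_of (Opmat A)"
    by (rule linear_conv_bounded_linear[THEN iffD1])
  show ?thesis
  proof
    show "\<exists>K. \<forall>A::'k cmat. norm (Opmat A) \<le> norm A * K"
      using bounded by (simp add: norm_opmat_def)
  qed (simp_all add: plus_opmat.abs_eq scaleR_opmat.abs_eq)
qed

text \<open>Entry (i, j) is a coordinate of the image of the unit vector \<open>axis j 1\<close>,
  hence at most the operator norm. The constant is the number of entries.\<close>

lemma bounded_linear_mat_of: "bounded_linear (mat_of :: ('k::finite) opmat \<Rightarrow> _)"
proof
  show "\<exists>K. \<forall>A::'k opmat. norm (mat_of A) \<le> norm A * K"
  proof (intro exI allI)
    fix A :: "'k opmat"
    have entry: "norm (mat_of A $ i $ j) \<le> norm A" for i j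
    proof -
      have "mat_of A $ i $ j = blinfun_apply (op_of A) (axis j 1) $ i"
        by (simp add: op_of_apply matrix_vector_mult_axis_nth)
      also have "norm \<dots> \<le> norm (blinfun_apply (op_of A) (axis j 1))"
        by (rule Finite_Cartesian_Product.norm_nth_le)
      also have "\<dots> \<le> norm (op_of A) * norm (axis j 1 :: complex^'k)"
        by (rule norm_blinfun)
      finally show ?thesis by (simp add: norm_opmat_def norm_axis_one)
    qed
    have "norm (mat_of A) \<le> (\<Sum>i\<in>UNIV. norm (mat_of A $ i))"
      unfolding norm_vec_def by (rule L2_set_le_sum) simp
    also have "\<dots> \<le> (\<Sum>(i::'k)\<in>UNIV. \<Sum>(j::'k)\<in>UNIV. norm A)"
    proof (rule sum_mono)
      fix i
      have "norm (mat_of A $ i) \<le> (\<Sum>j\<in>UNIV. norm (mat_of A $ i $ j))"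
        unfolding norm_vec_def by (rule L2_set_le_sum) simp
      also have "\<dots> \<le> (\<Sum>(j::'k)\<in>UNIV. norm A)" by (rule sum_mono) (rule entry)
      finally show "norm (mat_of A $ i) \<le> \<dots>" .
    qed
    also have "\<dots> = norm A * (real CARD('k) * real CARD('k))" by simp
    finally show "norm (mat_of A) \<le> norm A * (real CARD('k) * real CARD('k))" .
  qed
qed (simp_all add: plus_opmat.rep_eq scaleR_opmat.rep_eq)

instance opmat :: (finite) banach
proof
  fix A :: "nat \<Rightarrow> 'a opmat"
  assume "Cauchy A"
  then have "Cauchy (\<lambda>n. mat_of (A n))"
    by (rule bounded_linear.Cauchy[OF bounded_linear_mat_of])
  then obtain L where "(\<lambda>n. mat_of (A n)) \<longlonglongrightarrow> L"
    using Cauchy_convergent_iff convergent_def by blast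
  then have "(\<lambda>n. Opmat (mat_of (A n))) \<longlonglongrightarrow> Opmat L"
    by (rule bounded_linear.tendsto[OF bounded_linear_Opmat])
  then show "convergent A"
    by (auto simp: mat_of_inverse convergent_def)
qed

section \<open>The matrix exponential\<close>

lemma Opmat_funpow: "Opmat (((**) X ^^ k) (mat 1)) = Opmat X ^ k"
  by (induction k) (simp_all add: one_opmat_def flip: times_opmat.abs_eq)

lemma mexp_eq: "mexp X = mat_of (exp (Opmat X))"
proof -
  have "(\<lambda>k. Opmat X ^ k /\<^sub>R fact k) sums exp (Opmat X)"
    by (rule exp_converges)
  then have "(\<lambda>k. mat_of (Opmat X ^ k /\<^sub>R fact k)) sums mat_of (exp (Opmat X))"
    by (rule bounded_linear.sums[OF bounded_linear_mat_of])
  moreover have "mat_of (Opmat X ^ k /\<^sub>R fact k) = (1 / fact k :: real) *\<^sub>R (((**) X ^^ k) (mat 1))" for k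
    by (simp add: scaleR_opmat.rep_eq Opmat_inverse inverse_eq_divide flip: Opmat_funpow)
  ultimately show ?thesis
    unfolding mexp_def by (simp add: sums_iff)
qed

lemma Opmat_mexp: "Opmat (mexp X) = exp (Opmat X)"
  by (simp add: mexp_eq mat_of_inverse)

lemma bounded_bilinear_matrix_mult: "bounded_bilinear ((**) :: ('k::finite) cmat \<Rightarrow> 'k cmat \<Rightarrow> 'k cmat)"
  unfolding bilinear_conv_bounded_bilinear[symmetric] bilinear_def
  by (auto intro!: linearI simp: matrix_mult_add_rdistrib matrix_add_ldistrib
      scaleR_matrix_mult_left scaleR_matrix_mult_right)

lemma mexp_0 [simp]: "mexp 0 = mat 1"
  by (simp add: mexp_eq one_opmat.rep_eq flip: zero_opmat_def)

lemma mexp_add: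
  assumes "X ** Y = Y ** X"
  shows "mexp (X + Y) = mexp X ** mexp Y"
proof -
  have "Opmat X * Opmat Y = Opmat Y * Opmat X"
    using assms by (simp add: times_opmat.abs_eq)
  then show ?thesis
    by (simp add: mexp_eq exp_add_commuting times_opmat.rep_eq flip: plus_opmat.abs_eq)
qed

lemma matrix_mult_minus_left: "(- A) ** B = - ((A :: ('k::finite) cmat) ** (B :: 'k cmat))"
  by (rule bounded_bilinear.minus_left[OF bounded_bilinear_matrix_mult])

lemma matrix_mult_minus_right: "A ** (- B) = - ((A :: ('k::finite) cmat) ** (B :: 'k cmat))"
  by (rule bounded_bilinear.minus_right[OF bounded_bilinear_matrix_mult])

lemma mexp_minus_right: "mexp X ** mexp (- X) = mat 1"
  using mexp_add[of X "- X"] by (simp add: matrix_mult_minus_left matrix_mult_minus_right)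

lemma mexp_minus_left: "mexp (- X) ** mexp X = mat 1"
  using mexp_minus_right[of "- X"] by simp

lemma matrix_inv_mexp: "matrix_inv (mexp X) = mexp (- X)"
proof -
  \<comment> \<open>\<open>matrix_inv\<close> is a Hilbert choice, so uniqueness is needed; a right
    inverse is already determined.\<close>
  have "B = mexp (- X)" if "mexp X ** B = mat 1" for B
    using that mexp_minus_left[of X] by (metis matrix_mul_assoc matrix_mul_lid matrix_mul_rid)
  then show ?thesis
    unfolding matrix_inv_def
    by (intro some_equality) (simp_all add: mexp_minus_right mexp_minus_left)
qed

text \<open>The relation passes to all powers and then to the series. Stating it without an inverse
  of \<open>z\<close> lets it serve both for conjugation and for commuting with the singular
  matrices \<open>N2 p q\<close> and \<open>N2 q p\<close>.\<close>

lemma exp_intertwine: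
  fixes a b z :: "'a::{real_normed_algebra_1,banach}"
  assumes "a * z = z * b"
  shows "exp a * z = z * exp b"
proof -
  have "a ^ n * z = z * b ^ n" for n
  proof (induction n)
    case (Suc n)
    have "a ^ Suc n * z = a * (a ^ n * z)" by (simp add: mult.assoc)
    also have "\<dots> = z * b * b ^ n" using Suc assms by (simp flip: mult.assoc)
    finally show ?case by (simp add: mult.assoc)
  qed simp
  then have "(\<Sum>n. (a ^ n /\<^sub>R fact n) * z) = (\<Sum>n. z * (b ^ n /\<^sub>R fact n))"
    by (simp only: mult_scaleR_left mult_scaleR_right)
  then show ?thesis
    by (simp only: exp_def suminf_mult suminf_mult2 summable_exp_generic)
qed

lemma mexp_intertwine:
  fixes Z :: "('k::finite) cmat"
  assumes "X ** Z = Z ** Y"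
  shows "mexp X ** Z = Z ** mexp Y"
proof -
  have "Opmat X * Opmat Z = Opmat Z * Opmat Y"
    using assms by (simp add: times_opmat.abs_eq)
  from arg_cong[OF exp_intertwine[OF this], of mat_of] show ?thesis
    by (simp add: mexp_eq times_opmat.rep_eq Opmat_inverse)
qed

lemma mexp_conj:
  fixes g g' :: "('k::finite) cmat"
  assumes "g' ** g = mat 1" "g ** g' = mat 1"
  shows "mexp (g ** X ** g') = g ** mexp X ** g'"
proof -
  have "(g ** X ** g') ** g = g ** X"
    using assms(1) by (metis matrix_mul_assoc matrix_mul_rid)
  then have "mexp (g ** X ** g') ** g = g ** mexp X"
    by (rule mexp_intertwine)
  then show ?thesis
    using assms(2) by (metis matrix_mul_assoc matrix_mul_rid)
qed

lemma mexp_has_vector_derivative_at_0: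
  "((\<lambda>t. mexp (t *\<^sub>R X)) has_vector_derivative X) (at 0)"
proof -
  have "((\<lambda>t. mat_of (exp (t *\<^sub>R Opmat X))) has_vector_derivative
      mat_of (exp (0 *\<^sub>R Opmat X) * Opmat X)) (at 0)"
    by (rule bounded_linear.has_vector_derivative[OF bounded_linear_mat_of
          exp_scaleR_has_vector_derivative_right])
  then show ?thesis
    by (simp add: mexp_eq Opmat_inverse flip: scaleR_opmat.abs_eq)
qed

text \<open>Two independent exponents cover every use: \<open>Y = - X\<close> yields the bracket,
  and a zero exponent yields a one-sided product.\<close>

lemma mexp_matrix_mult_has_vector_derivative:
  fixes M :: "('k::finite) cmat"
  shows
  "((\<lambda>t. mexp (t *\<^sub>R X) ** M ** mexp (t *\<^sub>R Y)) has_vector_derivative X ** M + M ** Y) (at 0)"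
proof -
  note mult = bounded_bilinear.has_vector_derivative[OF bounded_bilinear_matrix_mult]
  note const = bounded_bilinear.bounded_linear_left[OF bounded_bilinear_matrix_mult]
  have "((\<lambda>t. mexp (t *\<^sub>R X) ** M) has_vector_derivative X ** M) (at 0)"
    by (rule bounded_linear.has_vector_derivative[OF const mexp_has_vector_derivative_at_0])
  from mult[OF this mexp_has_vector_derivative_at_0[of Y]] show ?thesis
    by (simp add: add.commute)
qed

section \<open>The Lie product formula\<close>

text \<open>Telescoping one factor at a time: each of the \<open>n\<close> terms contains one
  difference and \<open>n - 1\<close> factors of norm at most \<open>c\<close>.\<close>

lemma norm_power_diff_le:
  fixes a b :: "'a::real_normed_algebra_1"
  assumes "norm a \<le> c" "norm b \<le> c"
  shows "norm (a ^ n - b ^ n) \<le> n * c ^ (n - 1) * norm (a - b)"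
proof (induction n)
  case (Suc n)
  have c: "0 \<le> c" using assms(1) norm_ge_zero order_trans by blast
  have split: "a ^ Suc n - b ^ Suc n = a * (a ^ n - b ^ n) + (a - b) * b ^ n"
    by (simp add: algebra_simps)
  have "norm (a * (a ^ n - b ^ n)) \<le> c * (n * c ^ (n - 1) * norm (a - b))"
    by (rule order_trans[OF norm_mult_ineq]) (intro mult_mono Suc assms c, simp)
  also have "\<dots> = n * c ^ n * norm (a - b)"
    \<comment> \<open>At \<open>n = 0\<close> the truncated exponent \<open>n - 1\<close> is
      harmless because the factor \<open>n\<close> vanishes.\<close>
    by (cases n) simp_all
  finally have 1: "norm (a * (a ^ n - b ^ n)) \<le> n * c ^ n * norm (a - b)" .
  have "norm ((a - b) * b ^ n) \<le> norm (a - b) * norm b ^ n"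
    by (rule order_trans[OF norm_mult_ineq]) (simp add: mult_left_mono norm_power_ineq)
  also have "\<dots> \<le> norm (a - b) * c ^ n"
    by (intro mult_left_mono power_mono assms) simp_all
  finally have 2: "norm ((a - b) * b ^ n) \<le> norm (a - b) * c ^ n" .
  have "norm (a ^ Suc n - b ^ Suc n) \<le> n * c ^ n * norm (a - b) + norm (a - b) * c ^ n"
    unfolding split using norm_triangle_ineq 1 2 by (rule order_trans[OF _ add_mono])
  then show ?case by (simp add: algebra_simps)
qed simp

lemma exp_of_nat_scaleR:
  fixes x :: "'a::{real_normed_algebra_1,banach}"
  shows "exp (real n *\<^sub>R x) = exp x ^ n"
  by (induction n) (simp_all add: scaleR_add_left exp_add_commuting)

text \<open>The error \<open>d\<close> satisfies \<open>d 0 = 0\<close> and has derivative 0 there,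
  so \<open>d h / h\<close> tends to 0. Raising to the power \<open>Suc n\<close> amplifies the
  error at \<open>1 / Suc n\<close> by at most \<open>Suc n * exp K\<close>, which is exactly what
  this limit absorbs.\<close>

lemma exp_Lie_product:
  fixes x y :: "'a::{real_normed_algebra_1,banach}"
  shows "(\<lambda>n. (exp (x /\<^sub>R Suc n) * exp (y /\<^sub>R Suc n)) ^ Suc n) \<longlonglongrightarrow> exp (x + y)"
proof -
  define d where "d t = exp (t *\<^sub>R x) * exp (t *\<^sub>R y) - exp (t *\<^sub>R (x + y))" for t :: real
  \<comment> \<open>Chosen so that both the product of exponentials and the exponential of the sum
    have norm at most \<open>exp (K / Suc n)\<close>, whose power \<open>Suc n\<close> is
    independent of \<open>n\<close>.\<close>
  define K where "K = norm x + norm y"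
  let ?h = "\<lambda>n. inverse (real (Suc n))"
  have "(d has_vector_derivative 0) (at 0)"
    unfolding d_def
    by (rule derivative_eq_intros exp_scaleR_has_vector_derivative_right
          bounded_bilinear.has_vector_derivative[OF bounded_bilinear_mult])+ simp
  then have "((\<lambda>h. d h /\<^sub>R h) \<longlongrightarrow> 0) (at 0)"
    by (intro tendsto_norm_zero_cancel[where f = "\<lambda>h. d h /\<^sub>R h"])
      (simp add: has_vector_derivative_def has_derivative_at d_def norm_mult divide_inverse_commute)
  moreover have "filterlim ?h (at 0) sequentially"
    unfolding filterlim_at by (auto simp del: of_nat_Suc intro: LIMSEQ_inverse_real_of_nat)
  ultimately have lim: "(\<lambda>n. d (?h n) /\<^sub>R ?h n) \<longlonglongrightarrow> 0"
    by (rule filterlim_compose)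
  have bound: "norm ((exp (x /\<^sub>R Suc n) * exp (y /\<^sub>R Suc n)) ^ Suc n - exp (x + y))
      \<le> exp K * norm (d (?h n) /\<^sub>R ?h n)" for n
  proof -
    let ?a = "exp (x /\<^sub>R Suc n) * exp (y /\<^sub>R Suc n)" and ?b = "exp ((x + y) /\<^sub>R Suc n)"
    let ?c = "exp (K / Suc n)"
    have K: "norm x / real (Suc n) + norm y / real (Suc n) = K / real (Suc n)"
      by (simp add: K_def add_divide_distrib)
    have "norm ?a \<le> exp (norm (x /\<^sub>R Suc n)) * exp (norm (y /\<^sub>R Suc n))"
      by (rule order_trans[OF norm_mult_ineq]) (intro mult_mono norm_exp; simp)
    also have "\<dots> = exp (norm x / Suc n + norm y / Suc n)"
      by (simp add: exp_add divide_inverse_commute del: of_nat_Suc)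
    finally have a: "norm ?a \<le> ?c" unfolding K .
    have "norm ((x + y) /\<^sub>R Suc n) \<le> K / Suc n"
      by (simp add: K_def norm_triangle_ineq divide_inverse_commute mult_left_mono del: of_nat_Suc)
    then have b: "norm ?b \<le> ?c"
      using order_trans[OF norm_exp] exp_le_cancel_iff by blast
    have b_pow: "?b ^ Suc n = exp (x + y)"
      by (simp del: of_nat_Suc power_Suc flip: exp_of_nat_scaleR)
    have c: "?c ^ Suc n = exp K"
      using exp_of_nat_mult[of "Suc n" "K / Suc n"] by (simp del: of_nat_Suc power_Suc)
    have c1: "?c ^ n \<le> ?c ^ Suc n"
      by (rule power_increasing) (simp_all add: K_def)
    have "norm (?a ^ Suc n - exp (x + y)) \<le> Suc n * ?c ^ n * norm (?a - ?b)"
      using norm_power_diff_le[OF a b, of "Suc n"] by (simp only: b_pow diff_Suc_1)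
    also have "\<dots> \<le> Suc n * exp K * norm (?a - ?b)"
      using c1 unfolding c by (intro mult_left_mono mult_right_mono) simp_all
    also have "\<dots> = exp K * norm (d (?h n) /\<^sub>R ?h n)"
      by (simp add: d_def del: of_nat_Suc)
    finally show ?thesis .
  qed
  have "(\<lambda>n. exp K * norm (d (?h n) /\<^sub>R ?h n)) \<longlonglongrightarrow> 0"
    using tendsto_mult_right_zero tendsto_norm_zero lim by blast
  then have "(\<lambda>n. (exp (x /\<^sub>R Suc n) * exp (y /\<^sub>R Suc n)) ^ Suc n - exp (x + y)) \<longlonglongrightarrow> 0"
    by (rule Lim_null_comparison[rotated]) (use bound in simp)
  then show ?thesis
    by (rule LIM_zero_cancel)
qed

lemma mexp_Lie_product:
  fixes X Y :: "('k::finite) cmat"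
  shows "(\<lambda>n. ((**) (mexp (X /\<^sub>R Suc n) ** mexp (Y /\<^sub>R Suc n)) ^^ Suc n) (mat 1)) \<longlonglongrightarrow> mexp (X + Y)"
proof -
  have eq: "Opmat (((**) (mexp (X /\<^sub>R Suc n) ** mexp (Y /\<^sub>R Suc n)) ^^ Suc n) (mat 1)) =
      (exp (Opmat X /\<^sub>R Suc n) * exp (Opmat Y /\<^sub>R Suc n)) ^ Suc n" for n
    by (simp only: Opmat_funpow Opmat_mexp times_opmat.abs_eq[symmetric] scaleR_opmat.abs_eq)
  have "(\<lambda>n. mat_of ((exp (Opmat X /\<^sub>R Suc n) * exp (Opmat Y /\<^sub>R Suc n)) ^ Suc n)) \<longlonglongrightarrow>
      mat_of (exp (Opmat X + Opmat Y))"
    by (rule bounded_linear.tendsto[OF bounded_linear_mat_of exp_Lie_product])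
  then show ?thesis
    by (simp only: eq[symmetric] Opmat_inverse[OF UNIV_I] mexp_eq[of "X + Y"] plus_opmat.abs_eq)
qed

section \<open>Lie algebras of matrix groups\<close>

lemma GL_simps [simp]:
  "carrier GL = {X. invertible X}" "X \<otimes>\<^bsub>GL\<^esub> Y = X ** Y" "\<one>\<^bsub>GL\<^esub> = mat 1"
  by (simp_all add: GL_def)

lemma group_GL: "group (GL :: ('k::finite) cmat monoid)"
proof (rule groupI)
  show "\<exists>Y\<in>carrier GL. Y \<otimes>\<^bsub>GL\<^esub> X = \<one>\<^bsub>GL\<^esub>" if "X \<in> carrier GL" for X :: "'k cmat"
    using that unfolding GL_simps mem_Collect_eq invertible_def by blast
qed (simp_all add: invertible_mult matrix_mul_assoc, simp add: invertible_def exI[of _ "mat 1"])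

lemma invertible_mexp: "invertible (mexp X)"
  unfolding invertible_def using mexp_minus_left mexp_minus_right by blast

lemma subgroup_GL_funpow:
  assumes "subgroup S GL" "g \<in> S"
  shows "((**) g ^^ n) (mat 1) \<in> S"
  using subgroup.one_closed[OF assms(1)] subgroup.m_closed[OF assms(1,2)]
  by (induction n) simp_all

lemma lie_algebra_scaleR: "X \<in> lie_algebra S \<Longrightarrow> c *\<^sub>R X \<in> lie_algebra S"
  by (simp add: lie_algebra_def)

text \<open>Since \<open>S\<close> is closed only relative to \<open>U\<close>, the Lie product
  formula keeps the limit in a closed \<open>C\<close> with \<open>S = U \<inter> C\<close>; the
  last assumption supplies membership in \<open>U\<close>.\<close>

lemma lie_algebra_add:
  assumes S: "subgroup S GL" "closedin (top_of_set U) S"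
    and XY: "X \<in> lie_algebra S" "Y \<in> lie_algebra S" and U: "X + Y \<in> lie_algebra U"
  shows "X + Y \<in> lie_algebra S"
  unfolding lie_algebra_def
proof (intro CollectI allI)
  fix t :: real
  let ?a = "\<lambda>n. mexp ((t *\<^sub>R X) /\<^sub>R Suc n) ** mexp ((t *\<^sub>R Y) /\<^sub>R Suc n)"
  obtain C where C: "closed C" "S = U \<inter> C"
    using S(2) by (auto simp: closedin_closed)
  have mem: "mexp ((t *\<^sub>R Z) /\<^sub>R Suc n) \<in> S" if "Z \<in> lie_algebra S" for Z n
    using that unfolding lie_algebra_def scaleR_scaleR by blast
  have "?a n \<in> S" for n
    using subgroup.m_closed[OF S(1) mem[OF XY(1)] mem[OF XY(2)]] by simp
  then have "((**) (?a n) ^^ Suc n) (mat 1) \<in> C" for n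
    using subgroup_GL_funpow[OF S(1)] C(2) by blast
  then have "mexp (t *\<^sub>R X + t *\<^sub>R Y) \<in> C"
    by (rule closed_sequentially[OF C(1) _ mexp_Lie_product])
  moreover have "mexp (t *\<^sub>R X + t *\<^sub>R Y) \<in> U"
    using U by (simp add: lie_algebra_def scaleR_add_right)
  ultimately show "mexp (t *\<^sub>R (X + Y)) \<in> S"
    by (simp add: C(2) scaleR_add_right)
qed

text \<open>Difference quotients lie in \<open>V\<close>, and a subspace of a Euclidean space is
  closed. This is the passage from groups to Lie algebras used for h, for m and, with
  \<open>V = {0}\<close>, for equations.\<close>

lemma has_vector_derivative_in_subspace:
  fixes V :: "'a::euclidean_space set"
  assumes "subspace V" "(f has_vector_derivative v) (at x)" "\<And>t. f t \<in> V"
  shows "v \<in> V"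
proof -
  have "((\<lambda>h. (f (x + h) - f x) /\<^sub>R h) \<longlongrightarrow> v) (at 0)"
  proof (subst LIM_zero_iff[symmetric], rule tendsto_norm_zero_cancel)
    have "((\<lambda>h. norm (f (x + h) - f x - h *\<^sub>R v) / norm h) \<longlongrightarrow> 0) (at 0)"
      using assms(2) by (simp add: has_vector_derivative_def has_derivative_at)
    moreover have "\<forall>\<^sub>F h in at 0. norm (f (x + h) - f x - h *\<^sub>R v) / norm h =
        norm ((f (x + h) - f x) /\<^sub>R h - v)"
      unfolding eventually_at_filter
    proof (intro always_eventually allI impI)
      fix h :: real assume "h \<noteq> 0"
      then have "(f (x + h) - f x) /\<^sub>R h - v = (f (x + h) - f x - h *\<^sub>R v) /\<^sub>R h"
        by (simp add: algebra_simps)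
      then show "norm (f (x + h) - f x - h *\<^sub>R v) / norm h = norm ((f (x + h) - f x) /\<^sub>R h - v)"
        by (simp add: divide_inverse_commute)
    qed
    ultimately show "((\<lambda>h. norm ((f (x + h) - f x) /\<^sub>R h - v)) \<longlongrightarrow> 0) (at 0)"
      by (rule Lim_transform_eventually)
  qed
  moreover have "closed V" using assms(1) by (rule closed_subspace)
  moreover have "\<forall>\<^sub>F h in at 0. (f (x + h) - f x) /\<^sub>R h \<in> V"
    by (intro always_eventually allI subspace_scale[OF assms(1)] subspace_diff[OF assms(1)] assms(3))
  ultimately show ?thesis
    by (intro Lim_in_closed_set[OF _ _ at_neq_bot])
qed

text \<open>The bracket is the derivative at 0 of conjugation by the one-parameter group, so
  Ad-invariance gives ad-invariance.\<close>

lemma bracket_in_subspace: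
  assumes "subspace V" "\<And>t. mexp (t *\<^sub>R Z) ** M ** mexp (- t *\<^sub>R Z) \<in> V"
  shows "bracket Z M \<in> V"
proof -
  have "((\<lambda>t. mexp (t *\<^sub>R Z) ** M ** mexp (t *\<^sub>R (- Z))) has_vector_derivative bracket Z M) (at 0)"
    using mexp_matrix_mult_has_vector_derivative[of Z M "- Z"]
    by (simp add: bracket_def matrix_mult_minus_right)
  then show ?thesis
    by (rule has_vector_derivative_in_subspace[OF assms(1)]) (use assms(2) in simp)
qed

lemma mexp_commutes_imp_commutes:
  fixes X Z :: "('k::finite) cmat"
  assumes "\<And>t. mexp (t *\<^sub>R X) ** Z = Z ** mexp (t *\<^sub>R X)"
  shows "X ** Z = Z ** X"
proof -
  have "bracket X Z \<in> {0}"
  proof (rule has_vector_derivative_in_subspace)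
    show "((\<lambda>t. mexp (t *\<^sub>R X) ** Z ** mexp (t *\<^sub>R 0) - mexp (t *\<^sub>R 0) ** Z ** mexp (t *\<^sub>R X))
        has_vector_derivative bracket X Z) (at 0)"
      using has_vector_derivative_diff[OF mexp_matrix_mult_has_vector_derivative[of X Z 0]
          mexp_matrix_mult_has_vector_derivative[of 0 Z X]]
      by (simp add: bracket_def)
  qed (simp_all add: assms)
  then show ?thesis by (simp add: bracket_def)
qed

text \<open>In the Leibniz expansion only the identity permutation contributes to first order, and
  its product of diagonal entries differentiates to the trace.\<close>

lemma has_vector_derivative_det_mat_1:
  fixes M :: "real \<Rightarrow> ('k::finite) cmat"
  assumes M: "(M has_vector_derivative X) (at 0)" and M0: "M 0 = mat 1"
  shows "((\<lambda>t. det (M t)) has_vector_derivative trace X) (at 0)"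
proof -
  have entry: "((\<lambda>t. M t $ i $ j) has_derivative (\<lambda>h. h *\<^sub>R X $ i $ j)) (at 0)" for i j
    using M unfolding has_vector_derivative_def
    by (intro has_derivative_eq_rhs[OF bounded_linear.has_derivative[OF bounded_linear_vec_nth
          bounded_linear.has_derivative[OF bounded_linear_vec_nth]]]) auto
  have prod: "((\<lambda>t. \<Prod>i\<in>UNIV. M t $ i $ \<sigma> i) has_vector_derivative
      (if \<sigma> = id then trace X else 0)) (at 0)" if \<sigma>: "\<sigma> permutes UNIV" for \<sigma>
  proof -
    have "((\<lambda>t. \<Prod>i\<in>UNIV. M t $ i $ \<sigma> i) has_derivative
      (\<lambda>h. \<Sum>i\<in>UNIV. (h *\<^sub>R X $ i $ \<sigma> i) * (\<Prod>j\<in>UNIV - {i}. M 0 $ j $ \<sigma> j))) (at 0)"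
      by (rule has_derivative_prod) (rule entry)
    moreover have "(\<Sum>i\<in>UNIV. (h *\<^sub>R X $ i $ \<sigma> i) * (\<Prod>j\<in>UNIV - {i}. M 0 $ j $ \<sigma> j)) =
      h *\<^sub>R (if \<sigma> = id then trace X else 0)" for h
    proof (cases "\<sigma> = id")
      case True
      then show ?thesis by (simp add: M0 mat_def trace_def scaleR_sum_right)
    next
      case False
      have "(\<Prod>j\<in>UNIV - {i}. M 0 $ j $ \<sigma> j) = 0" for i
      proof -
        \<comment> \<open>A permutation other than the identity moves at least two points, here
          \<open>j\<close> and \<open>\<sigma> j\<close>. One of them differs from the deleted index
          \<open>i\<close> and contributes an off-diagonal zero of the identity matrix.\<close>
        obtain j where j: "\<sigma> j \<noteq> j" using False by (auto simp: fun_eq_iff)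
        then have "\<sigma> (\<sigma> j) \<noteq> \<sigma> j"
          using permutes_inj[OF \<sigma>] by (metis injD)
        then obtain k where "k \<noteq> i" "\<sigma> k \<noteq> k" using j by metis
        then show ?thesis
          by (intro prod_zero bexI[of _ k]) (simp_all add: M0 mat_def)
      qed
      then show ?thesis using False by (simp only: mult_zero_right sum.neutral_const if_False scaleR_zero_right)
    qed
    ultimately show ?thesis
      by (simp add: has_vector_derivative_def)
  qed
  have "((\<lambda>t. \<Sum>\<sigma>\<in>{\<sigma>. \<sigma> permutes UNIV}. of_int (sign \<sigma>) * (\<Prod>i\<in>UNIV. M t $ i $ \<sigma> i))
      has_vector_derivative
      (\<Sum>\<sigma>\<in>{\<sigma>. \<sigma> permutes (UNIV :: 'k set)}. of_int (sign \<sigma>) * (if \<sigma> = id then trace X else 0))) (at 0)"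
    by (intro has_vector_derivative_sum has_vector_derivative_mult_right prod) simp
  moreover have "(\<Sum>\<sigma>\<in>{\<sigma>. \<sigma> permutes (UNIV :: 'k set)}. of_int (sign \<sigma>) * (if \<sigma> = id then trace X else 0)) = trace X"
  proof -
    have "of_int (sign \<sigma>) * (if \<sigma> = id then trace X else 0) = (if id = \<sigma> then trace X else 0)" for \<sigma> :: "'k \<Rightarrow> 'k"
      by (simp add: sign_id)
    then show ?thesis
      by (simp only: sum.delta' finite_permutations[OF finite] mem_Collect_eq permutes_id if_True)
  qed
  ultimately show ?thesis by (simp only: det_def)
qed

lemma trace_eq_0_if_det_mexp_eq_1:
  assumes "\<And>t. det (mexp (t *\<^sub>R X)) = 1"
  shows "trace X = 0"
proof -
  have "((\<lambda>t. det (mexp (t *\<^sub>R X))) has_vector_derivative trace X) (at 0)"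
    by (rule has_vector_derivative_det_mat_1[OF mexp_has_vector_derivative_at_0]) simp
  then have "((\<lambda>t::real. 1) has_vector_derivative trace X) (at 0)"
    by (simp only: assms)
  then show ?thesis
    by (rule vector_derivative_unique_at[OF _ has_vector_derivative_const])
qed

section \<open>Brackets\<close>

lemma bracket_simps:
  fixes X Y Z :: "('k::finite) cmat"
  shows "bracket (X + Y) Z = bracket X Z + bracket Y Z"
    and "bracket X (Y + Z) = bracket X Y + bracket X Z"
    and "bracket (c *\<^sub>R X) Y = c *\<^sub>R bracket X Y"
    and "bracket X (c *\<^sub>R Y) = c *\<^sub>R bracket X Y"
    and "bracket 0 X = 0" and "bracket X 0 = 0"
  by (simp_all add: bracket_def matrix_mult_add_rdistrib matrix_add_ldistrib
      scaleR_matrix_mult_left scaleR_matrix_mult_right scaleR_diff_right)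

lemma bracket_skew: "bracket X Y = - bracket Y X"
  by (simp add: bracket_def)

lemma bracket_eq_0_iff: "bracket X Y = 0 \<longleftrightarrow> X ** Y = Y ** X"
  by (simp add: bracket_def)

lemma bracket_Jacobi:
  fixes X Y Z :: "('k::finite) cmat"
  shows "bracket X (bracket Y Z) = bracket (bracket X Y) Z + bracket Y (bracket X Z)"
proof -
  note diff_left = bounded_bilinear.diff_left[OF bounded_bilinear_matrix_mult]
  note diff_right = bounded_bilinear.diff_right[OF bounded_bilinear_matrix_mult]
  show ?thesis
    by (simp add: bracket_def diff_left diff_right matrix_mul_assoc)
qed

lemma N2_mult:
  "(N2 p q ** X) $ i $ j = (if i = p then \<i> * X $ q $ j else 0)"
  "(X ** N2 p q) $ i $ j = (if j = q then \<i> * X $ i $ p else 0)"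
  by (auto simp: matrix_matrix_mult_def N2_def if_distrib if_distribR cong: if_cong)

text \<open>The diagonal entries of \<open>A0 p q\<close>. Their differences are the eigenvalues of
  ad A0 on the matrix units: 1 on the entries used by n1, 2 at (p, q), 0 on k0.\<close>

definition A0_weight :: "'k \<Rightarrow> 'k \<Rightarrow> 'k \<Rightarrow> complex" where
  "A0_weight p q i = (if i = p then 1 else if i = q then -1 else 0)"

lemma bracket_A0_nth:
  assumes "p \<noteq> q"
  shows "bracket (A0 p q) X $ i $ j = (A0_weight p q i - A0_weight p q j) * X $ i $ j"
proof -
  have A0: "A0 p q $ i $ j = (if i = j then A0_weight p q i else 0)" for i j
    using assms by (auto simp: A0_def block_diag_def A0_weight_def)
  have "(A0 p q ** X) $ i $ j = A0_weight p q i * X $ i $ j"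
    by (simp add: matrix_matrix_mult_def A0 if_distrib[of "\<lambda>x. x * _"] cong: if_cong)
  moreover have "(X ** A0 p q) $ i $ j = X $ i $ j * A0_weight p q j"
    by (simp add: matrix_matrix_mult_def A0 if_distrib[of "\<lambda>x. _ * x"] cong: if_cong)
  ultimately show ?thesis
    by (simp add: bracket_def algebra_simps)
qed

lemma sum_UNIV_remove_two:
  assumes "p \<noteq> q"
  shows "sum f (UNIV :: ('k::finite) set) = sum f (- {p, q}) + f p + (f q :: complex)"
proof -
  have "sum f UNIV = sum f (- {p, q}) + sum f {p, q}"
    by (subst sum.union_disjoint[symmetric]) (auto simp: Un_commute)
  then show ?thesis using assms by simp
qed

text \<open>Commuting with \<^term>\<open>N2 p q\<close> and \<^term>\<open>N2 q p\<close>, that is, with the elementary matrices at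
  \<open>(p, q)\<close> and \<open>(q, p)\<close>, forces the block shape \<open>diag(B, z, z)\<close>.\<close>

lemma commutes_N2_entries:
  assumes "X ** N2 p q = N2 p q ** X" "X ** N2 q p = N2 q p ** X"
  shows "X $ p $ p = X $ q $ q"
    and "i \<noteq> p \<Longrightarrow> X $ i $ p = 0" "i \<noteq> p \<Longrightarrow> X $ p $ i = 0"
    and "i \<noteq> q \<Longrightarrow> X $ i $ q = 0" "i \<noteq> q \<Longrightarrow> X $ q $ i = 0"
proof -
  have 1: "(if j = q then \<i> * X $ i $ p else 0) = (if i = p then \<i> * X $ q $ j else 0)" for i j
    using arg_cong[OF assms(1), of "\<lambda>M. M $ i $ j"] unfolding N2_mult .
  have 2: "(if j = p then \<i> * X $ i $ q else 0) = (if i = q then \<i> * X $ p $ j else 0)" for i j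
    using arg_cong[OF assms(2), of "\<lambda>M. M $ i $ j"] unfolding N2_mult .
  show "X $ p $ p = X $ q $ q" using 1[of q p] by simp
  show "X $ i $ p = 0" if "i \<noteq> p" using 1[of q i] that by simp
  show "X $ q $ i = 0" if "i \<noteq> q" using 1[of i p] that by simp
  show "X $ i $ q = 0" if "i \<noteq> q" using 2[of p i] that by simp
  show "X $ p $ i = 0" if "i \<noteq> p" using 2[of i q] that by simp
qed

text \<open>Trades the existential block form for linear equations that can be tested on
  one-parameter groups. The two commutation relations force diag(B, z, z), skewness makes B
  skew-Hermitian and z imaginary, and the trace is the normalization.\<close>

lemma k0_alg_iff:
  assumes "p \<noteq> q"
  shows "X \<in> k0_alg p q \<longleftrightarrow>
    X ** N2 p q = N2 p q ** X \<and> X ** N2 q p = N2 q p ** X \<and>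
    (\<forall>i j. cnj (X $ j $ i) = - X $ i $ j) \<and> trace X = 0" (is "_ \<longleftrightarrow> ?R")
proof
  assume "X \<in> k0_alg p q"
  then obtain B and c :: real where X: "X = block_diag p q B (\<i> * of_real c) (\<i> * of_real c)"
    and B: "\<forall>i\<in>-{p, q}. \<forall>j\<in>-{p, q}. cnj (B $ j $ i) = - B $ i $ j"
    and tr: "(\<Sum>i\<in>-{p, q}. B $ i $ i) + 2 * \<i> * of_real c = 0"
    unfolding k0_alg_def by blast
  have "(\<Sum>i\<in>-{p, q}. X $ i $ i) = (\<Sum>i\<in>-{p, q}. B $ i $ i)"
    unfolding X block_diag_def by (intro sum.cong) auto
  then have "trace X = 0"
    using tr assms unfolding trace_def sum_UNIV_remove_two[OF assms] by (simp add: X block_diag_def algebra_simps)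
  moreover have "cnj (X $ j $ i) = - X $ i $ j" for i j
    using B assms by (auto simp: X block_diag_def)
  ultimately show ?R
    using assms by (auto simp: vec_eq_iff N2_mult X block_diag_def)
next
  assume R: ?R
  then have "X ** N2 p q = N2 p q ** X" "X ** N2 q p = N2 q p ** X"
    by (simp_all only:)
  note entries = commutes_N2_entries[OF this]
  have "cnj (X $ p $ p) + X $ p $ p = 0"
    using R by (simp only: eq_neg_iff_add_eq_0)
  from arg_cong[OF this, of Re] have "Re (X $ p $ p) = 0"
    by simp
  then have "X $ p $ p = \<i> * of_real (Im (X $ p $ p))"
    by (simp only: complex_eq_iff) simp
  then obtain c :: real where X3: "X $ p $ p = \<i> * of_real c"
    by (rule that)
  have "X = block_diag p q X (X $ p $ p) (X $ p $ p)"
    unfolding vec_eq_iff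
  proof (intro allI)
    fix i j
    show "X $ i $ j = block_diag p q X (X $ p $ p) (X $ p $ p) $ i $ j"
      using assms by (cases "i = p"; cases "i = q"; cases "j = p"; cases "j = q")
        (simp_all add: block_diag_def entries flip: entries(1))
  qed
  moreover have "(\<Sum>i\<in>-{p, q}. X $ i $ i) + 2 * (X $ p $ p) = 0"
    using R entries(1) unfolding trace_def sum_UNIV_remove_two[OF assms] by (simp add: add.commute)
  ultimately have "X = block_diag p q X (\<i> * of_real c) (\<i> * of_real c)"
    "(\<Sum>i\<in>-{p, q}. X $ i $ i) + 2 * \<i> * of_real c = 0"
    unfolding X3 by (simp_all only: mult.assoc)
  then show "X \<in> k0_alg p q"
    using R unfolding k0_alg_def by blast
qed

lemma k0_alg_entries:
  assumes "X \<in> k0_alg p q" "p \<noteq> q"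
  shows "cnj (X $ j $ i) = - X $ i $ j" "X $ p $ p = X $ q $ q"
    and "i \<noteq> p \<Longrightarrow> X $ i $ p = 0" "i \<noteq> p \<Longrightarrow> X $ p $ i = 0"
    and "i \<noteq> q \<Longrightarrow> X $ i $ q = 0" "i \<noteq> q \<Longrightarrow> X $ q $ i = 0"
proof -
  show "cnj (X $ j $ i) = - X $ i $ j" using assms k0_alg_iff by blast
qed (use assms in \<open>auto simp: k0_alg_def block_diag_def\<close>)

lemma subspace_k0_alg:
  assumes "p \<noteq> q"
  shows "subspace (k0_alg p q)"
  unfolding subspace_def
  by (auto simp: k0_alg_iff[OF assms] matrix_mult_add_rdistrib matrix_add_ldistrib scaleR_matrix_mult_left
      scaleR_matrix_mult_right trace_def sum.distrib
      simp flip: scaleR_sum_right)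

text \<open>The eigenvalue 1 of ad A0 occurs exactly on row p and column q away from the indices p
  and q; the second condition ties that row to that column. In this form invariance under k0 reduces
  largely to the Jacobi identity.\<close>

lemma n1_alg_iff:
  assumes "p \<noteq> q"
  shows "X \<in> n1_alg p q \<longleftrightarrow>
    bracket (A0 p q) X = X \<and> (\<forall>j\<in>-{p, q}. X $ p $ j = - cnj (X $ j $ q))" (is "_ \<longleftrightarrow> ?R")
proof
  assume "X \<in> n1_alg p q"
  then obtain v where X: "X = n1_elem p q v" unfolding n1_alg_def by blast
  have "bracket (A0 p q) X $ i $ j = X $ i $ j" for i j
    unfolding bracket_A0_nth[OF assms] using assms by (simp add: X n1_elem_def A0_weight_def)
  moreover have "X $ p $ j = - cnj (X $ j $ q)" if "j \<in> -{p, q}" for j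
    using that assms by (simp add: X n1_elem_def)
  ultimately show ?R by (simp add: vec_eq_iff)
next
  assume R: ?R
  then have "(A0_weight p q i - A0_weight p q j) * X $ i $ j = X $ i $ j" for i j
    by (metis bracket_A0_nth[OF assms])
  then have zero: "X $ i $ j = 0" if "A0_weight p q i - A0_weight p q j \<noteq> 1" for i j
    using that by (simp only: mult_cancel_right2) blast
  have "X = n1_elem p q (\<chi> i. X $ i $ q)"
    unfolding vec_eq_iff
  proof (intro allI)
    fix i j
    show "X $ i $ j = n1_elem p q (\<chi> i. X $ i $ q) $ i $ j"
      using assms R by (cases "i = p"; cases "i = q"; cases "j = p"; cases "j = q")
        (simp_all add: n1_elem_def zero A0_weight_def)
  qed
  then show "X \<in> n1_alg p q" unfolding n1_alg_def by blast
qed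

lemma n1_alg_nth:
  assumes "X \<in> n1_alg p q"
  shows "X $ i $ j = (if i \<in> -{p, q} \<and> j = q then X $ i $ q
    else if i = p \<and> j \<in> -{p, q} then - cnj (X $ j $ q) else 0)"
  using assms by (auto simp: n1_alg_def n1_elem_def)

lemma subspace_n1_alg:
  assumes "p \<noteq> q"
  shows "subspace (n1_alg p q)"
  unfolding subspace_def
  by (auto simp: n1_alg_iff[OF assms] bracket_simps)

lemma bracket_N2_k0:
  "p \<noteq> q \<Longrightarrow> E \<in> k0_alg p q \<Longrightarrow> bracket E (N2 p q) = 0"
  by (simp add: bracket_eq_0_iff k0_alg_iff)

lemma bracket_A0_k0:
  assumes "p \<noteq> q" "E \<in> k0_alg p q"
  shows "bracket (A0 p q) E = 0"
  unfolding vec_eq_iff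
proof (intro allI)
  fix i j
  show "bracket (A0 p q) E $ i $ j = 0 $ i $ j"
    using k0_alg_entries(3-6)[OF assms(2,1), of i] k0_alg_entries(3-6)[OF assms(2,1), of j]
    by (auto simp: bracket_A0_nth[OF assms(1)] A0_weight_def)
qed

lemma bracket_A0_N2: "p \<noteq> q \<Longrightarrow> bracket (A0 p q) (N2 p q) = 2 *\<^sub>R N2 p q"
  by (auto simp: vec_eq_iff bracket_A0_nth A0_weight_def N2_def scaleR_conv_of_real)

lemma bracket_N2_n1:
  assumes "p \<noteq> q" "X \<in> n1_alg p q"
  shows "bracket (N2 p q) X = 0"
proof -
  have "X $ q $ j = 0" "X $ i $ p = 0" for i j
    using assms n1_alg_nth[OF assms(2), of q j] n1_alg_nth[OF assms(2), of i p] by simp_all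
  then show ?thesis by (simp add: vec_eq_iff bracket_def N2_mult)
qed

text \<open>\<open>E\<close> commutes with A0, so the weight is preserved. For the link between row
  p and column q, conjugation exchanges the two products: (EX) at (p, j) is the conjugate of (XE) at
  (j, q), which needs \<open>E $ p $ p = E $ q $ q\<close>, and (XE) at (p, j) is the conjugate of
  (EX) at (j, q).\<close>

lemma bracket_k0_n1:
  assumes "p \<noteq> q" "E \<in> k0_alg p q" "X \<in> n1_alg p q"
  shows "bracket E X \<in> n1_alg p q"
  unfolding n1_alg_iff[OF assms(1)]
proof (intro conjI ballI)
  show "bracket (A0 p q) (bracket E X) = bracket E X"
    using bracket_A0_k0[OF assms(1,2)] assms(3) n1_alg_iff[OF assms(1), of X]
    by (simp add: bracket_Jacobi[of "A0 p q" E X] bracket_simps)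
  fix j assume j: "j \<in> -{p, q}"
  note E = k0_alg_entries[OF assms(2,1)]
  note X = n1_alg_nth[OF assms(3)]
  have "(E ** X) $ p $ j = (\<Sum>k\<in>UNIV. if k = p then E $ p $ p * X $ p $ j else 0)"
    using E(4) by (simp only: matrix_matrix_mult_def vec_lambda_beta) (rule sum.cong; auto)
  then have 1: "(E ** X) $ p $ j = - E $ q $ q * cnj (X $ j $ q)"
    using X[of p j] j E(2) by simp
  have "cnj ((X ** E) $ j $ q) = (\<Sum>k\<in>UNIV. if k = q then cnj (X $ j $ q) * cnj (E $ q $ q) else 0)"
    using E(5) by (simp only: matrix_matrix_mult_def vec_lambda_beta cnj_sum) (rule sum.cong; auto)
  then have 2: "cnj ((X ** E) $ j $ q) = - E $ q $ q * cnj (X $ j $ q)"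
    using E(1)[of q q] by simp
  have 3: "(X ** E) $ p $ j = cnj ((E ** X) $ j $ q)"
  proof -
    have "X $ p $ k * E $ k $ j = cnj (E $ j $ k) * cnj (X $ k $ q)" for k
    proof (cases "k \<in> -{p, q}")
      case True
      then show ?thesis using X[of p k] E(1)[of j k] by simp
    next
      case False
      then have "E $ k $ j = 0" "E $ j $ k = 0"
        using E(3,4,5,6)[of j] j by auto
      then show ?thesis by simp
    qed
    then show ?thesis by (simp add: matrix_matrix_mult_def)
  qed
  show "bracket E X $ p $ j = - cnj (bracket E X $ j $ q)"
    by (simp add: bracket_def 1 2 3)
qed

text \<open>For X, Y with vectors v, w the product XY has the single entry -v^* w at (p, q). The
  bracket therefore has the entry w^* v - v^* w, which is 2i times Im (w^* v).\<close>

lemma bracket_n1_n1: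
  assumes "p \<noteq> q" "X \<in> n1_alg p q" "Y \<in> n1_alg p q"
  shows "bracket X Y = (2 * omega0 p q X Y) *\<^sub>R N2 p q"
proof -
  have mult: "(X ** Y) $ i $ j = (if i = p \<and> j = q then - (\<Sum>k\<in>-{p, q}. cnj (X $ k $ q) * Y $ k $ q) else 0)"
    if "X \<in> n1_alg p q" "Y \<in> n1_alg p q" for X Y i j
  proof -
    note X = n1_alg_nth[OF that(1)] and Y = n1_alg_nth[OF that(2)]
    have "(X ** Y) $ i $ j = (\<Sum>k\<in>-{p, q}. X $ i $ k * Y $ k $ j)"
      using X[of i p] Y[of q j] assms(1)
      by (simp add: matrix_matrix_mult_def sum_UNIV_remove_two[OF assms(1)])
    also have "\<dots> = (\<Sum>k\<in>-{p, q}. if i = p \<and> j = q then - (cnj (X $ k $ q) * Y $ k $ q) else 0)"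
    proof (rule sum.cong)
      fix k assume "k \<in> -{p, q}"
      then show "X $ i $ k * Y $ k $ j = (if i = p \<and> j = q then - (cnj (X $ k $ q) * Y $ k $ q) else 0)"
        using X[of i k] Y[of k j] by auto
    qed simp
    finally show ?thesis
      by (cases "i = p \<and> j = q") (simp_all only: simp_thms if_True if_False sum_negf sum.neutral_const)
  qed
  let ?s = "\<Sum>k\<in>-{p, q}. cnj (Y $ k $ q) * X $ k $ q"
  have "(\<Sum>k\<in>-{p, q}. cnj (X $ k $ q) * Y $ k $ q) = cnj ?s"
    by (simp add: mult.commute)
  moreover have "s - cnj s = of_real (2 * Im s) * \<i>" for s
    by (simp add: complex_eq_iff)
  then have "?s - cnj ?s = of_real (2 * omega0 p q X Y) * \<i>"
    unfolding omega0_def .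
  ultimately show ?thesis
    by (auto simp: vec_eq_iff bracket_def mult[OF assms(2,3)] mult[OF assms(3,2)] N2_def
        scaleR_conv_of_real[where 'a = complex])
qed

section \<open>The isotropy algebra\<close>

lemma mexp_in_k0_group: "X \<in> k0_alg p q \<Longrightarrow> mexp X \<in> K0_grp p q"
  unfolding K0_grp_def connected_group_def by (intro generate.incl imageI)

lemma subgroup_K0_grp: "subgroup (K0_grp p q) GL"
  unfolding K0_grp_def connected_group_def
  by (rule group.generate_is_subgroup[OF group_GL]) (auto intro: invertible_mexp)

lemma k0_alg_subset_lie_algebra:
  assumes "p \<noteq> q" "X \<in> k0_alg p q"
  shows "X \<in> lie_algebra (K0_grp p q)"
  using assms subspace_scale[OF subspace_k0_alg] mexp_in_k0_group
  unfolding lie_algebra_def by blast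

lemma inv_GL_mexp: "inv\<^bsub>GL\<^esub> (mexp X) = mexp (- X)"
  by (rule group.inv_equality[OF group_GL]) (simp_all add: mexp_minus_left invertible_mexp)

text \<open>Commuting with a fixed matrix is inherited by products and inverses of generators.
  \<open>N2 q p\<close> is the transpose of \<open>N2 p q\<close>.\<close>

lemma K0_grp_commutes:
  assumes "p \<noteq> q" "Z = N2 p q \<or> Z = N2 q p" "g \<in> K0_grp p q"
  shows "g ** Z = Z ** g"
proof -
  have gen: "mexp X ** Z = Z ** mexp X" if "X \<in> k0_alg p q" for X
    by (rule mexp_intertwine) (use that assms in \<open>auto simp: k0_alg_iff\<close>)
  show ?thesis
    using assms(3) unfolding K0_grp_def connected_group_def
  proof (induction rule: generate.induct)
    case one
    then show ?case by simp
  next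
    case (incl h)
    then show ?case using gen by blast
  next
    case (inv h)
    then obtain X where X: "X \<in> k0_alg p q" "h = mexp X" by blast
    have "- X \<in> k0_alg p q"
      using subspace_neg[OF subspace_k0_alg[OF assms(1)] X(1)] .
    then show ?case using gen by (simp add: X(2) inv_GL_mexp)
  next
    case (eng h1 h2)
    then have "h1 ** (h2 ** Z) = Z ** h1 ** h2"
      by (simp add: matrix_mul_assoc)
    then show ?case by (simp add: matrix_mul_assoc)
  qed
qed

lemma lie_algebra_conj:
  assumes "subgroup S GL" "X \<in> lie_algebra S" "mexp Z \<in> S"
  shows "mexp Z ** X ** mexp (- Z) \<in> lie_algebra S"
  unfolding lie_algebra_def
proof (intro CollectI allI)
  fix t :: real
  have inv: "mexp (- Z) \<in> S"
    using subgroup.m_inv_closed[OF assms(1,3)] by (simp add: inv_GL_mexp)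
  have "mexp (t *\<^sub>R X) \<in> S" using assms(2) by (simp add: lie_algebra_def)
  then have "mexp Z ** mexp (t *\<^sub>R X) ** mexp (- Z) \<in> S"
    using subgroup.m_closed[OF assms(1)] assms(3) inv by simp
  moreover have "t *\<^sub>R (mexp Z ** X ** mexp (- Z)) = mexp Z ** (t *\<^sub>R X) ** mexp (- Z)"
    by (simp add: scaleR_matrix_mult_left scaleR_matrix_mult_right)
  ultimately show "mexp (t *\<^sub>R (mexp Z ** X ** mexp (- Z))) \<in> S"
    by (simp add: mexp_conj mexp_minus_left mexp_minus_right)
qed

lemma zero_in_n_alg: "0 \<in> n_alg p q"
proof -
  have "n1_elem p q 0 = 0" by (simp add: n1_elem_def vec_eq_iff)
  then have "0 \<in> n1_alg p q" unfolding n1_alg_def by (metis rangeI)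
  then show ?thesis unfolding n_alg_def
    by (intro CollectI exI[of _ 0]) (simp add: span_zero)
qed

lemma mult_mem_G_grp: "g \<in> F \<Longrightarrow> h \<in> N_grp p q \<Longrightarrow> g ** h \<in> G_grp p q F"
  unfolding G_grp_def set_mult_def GL_simps by blast

lemma F_subset_G_grp: "F \<subseteq> G_grp p q F"
proof
  fix g assume "g \<in> F"
  moreover have "mat 1 \<in> N_grp p q"
    unfolding N_grp_def using zero_in_n_alg mexp_0 by (metis imageI)
  ultimately show "g \<in> G_grp p q F"
    using mult_mem_G_grp by (metis matrix_mul_rid)
qed

lemma n_alg_subset_lie_algebra:
  assumes "subgroup F GL" "p \<noteq> q" "X \<in> n1_alg p q"
  shows "X + c *\<^sub>R N2 p q \<in> lie_algebra (G_grp p q F)"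
  unfolding lie_algebra_def
proof (intro CollectI allI)
  fix t :: real
  have "t *\<^sub>R (X + c *\<^sub>R N2 p q) \<in> n_alg p q"
    unfolding n_alg_def scaleR_add_right
    using subspace_scale[OF subspace_n1_alg[OF assms(2)] assms(3)] span_base[of "N2 p q" "{N2 p q}"]
    by (blast intro: span_scale)
  then have "mexp (t *\<^sub>R (X + c *\<^sub>R N2 p q)) \<in> N_grp p q"
    unfolding N_grp_def by blast
  moreover have "mat 1 \<in> F" using subgroup.one_closed[OF assms(1)] by simp
  ultimately show "mexp (t *\<^sub>R (X + c *\<^sub>R N2 p q)) \<in> G_grp p q F"
    using mult_mem_G_grp by (metis matrix_mul_lid)
qed

text \<open>The Gram matrix of the form is the permutation matrix exchanging p and q, so pairing
  with a unit vector reads off the coordinate at the exchanged index.\<close>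

lemma hform_axis:
  assumes "p \<noteq> q"
  shows "hform p q x (axis i 1) = x $ (if i = p then q else if i = q then p else i)"
    and "hform p q (axis i 1) x = cnj (x $ (if i = p then q else if i = q then p else i))"
proof -
  have "(\<Sum>k\<in>-{p, q}. cnj (axis i 1 $ k) * x $ k) = (\<Sum>k\<in>-{p, q}. if k = i then x $ i else 0)"
    by (rule sum.cong) (auto simp: axis_def)
  then have s1: "(\<Sum>k\<in>-{p, q}. cnj (axis i 1 $ k) * x $ k) = (if i \<in> -{p, q} then x $ i else 0)"
    by simp
  have "(\<Sum>k\<in>-{p, q}. cnj (x $ k) * axis i 1 $ k) = (\<Sum>k\<in>-{p, q}. if k = i then cnj (x $ i) else 0)"
    by (rule sum.cong) (auto simp: axis_def)
  then have s2: "(\<Sum>k\<in>-{p, q}. cnj (x $ k) * axis i 1 $ k) = (if i \<in> -{p, q} then cnj (x $ i) else 0)"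
    by simp
  show "hform p q x (axis i 1) = x $ (if i = p then q else if i = q then p else i)"
    using assms unfolding hform_def s1 s2
    by (cases "i = p"; cases "i = q") (simp_all add: axis_def)
  show "hform p q (axis i 1) x = cnj (x $ (if i = p then q else if i = q then p else i))"
    using assms unfolding hform_def s1 s2
    by (cases "i = p"; cases "i = q") (simp_all add: axis_def)
qed

lemma bounded_bilinear_hform: "bounded_bilinear (hform p q)"
  unfolding bilinear_conv_bounded_bilinear[symmetric] bilinear_def
  by (auto intro!: linearI simp: hform_def algebra_simps sum.distrib scaleR_sum_right)

lemma lie_algebra_SU_n1:
  assumes "X \<in> lie_algebra (SU_n1 p q)"
  shows "trace X = 0" and "hform p q (X *v x) y + hform p q x (X *v y) = 0"
proof -
  have SU: "mexp (t *\<^sub>R X) \<in> SU_n1 p q" for t using assms by (simp add: lie_algebra_def)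
  then show "trace X = 0"
    by (intro trace_eq_0_if_det_mexp_eq_1) (simp add: SU_n1_def)
  have "linear (\<lambda>A :: 'a cmat. A *v z)" for z :: "complex^'a"
    by (rule linearI) (simp_all add: matrix_vector_mult_add_rdistrib scaleR_matrix_vector_mult)
  then have d: "((\<lambda>t. mexp (t *\<^sub>R X) *v z) has_vector_derivative X *v z) (at 0)" for z
    using bounded_linear.has_vector_derivative[OF _ mexp_has_vector_derivative_at_0]
      linear_conv_bounded_linear by blast
  have "((\<lambda>t. hform p q (mexp (t *\<^sub>R X) *v x) (mexp (t *\<^sub>R X) *v y)) has_vector_derivative
      hform p q x (X *v y) + hform p q (X *v x) y) (at 0)"
    using bounded_bilinear.has_vector_derivative[OF bounded_bilinear_hform d d] by simp
  moreover have "hform p q (mexp (t *\<^sub>R X) *v x) (mexp (t *\<^sub>R X) *v y) = hform p q x y" for t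
    using SU unfolding SU_n1_def by blast
  ultimately have "((\<lambda>t::real. hform p q x y) has_vector_derivative
      hform p q x (X *v y) + hform p q (X *v x) y) (at 0)"
    by simp
  from vector_derivative_unique_at[OF this has_vector_derivative_const]
  show "hform p q (X *v x) y + hform p q x (X *v y) = 0"
    by (simp add: add.commute)
qed

lemma nonsymmetric_descriptionD:
  assumes "nonsymmetric_description p q F"
  shows "subgroup F GL" "closedin (top_of_set (K0_grp p q <#>\<^bsub>GL\<^esub> A_grp p q)) F"
    "G_grp p q F \<subseteq> SU_n1 p q"
  using assms by (simp_all only: nonsymmetric_description_def homogeneous_description_def)

lemma lie_algebra_H_grp:
  assumes "p \<noteq> q" "nonsymmetric_description p q F"
  shows "lie_algebra (H_grp p q F) \<subseteq> k0_alg p q"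
proof
  fix X assume X: "X \<in> lie_algebra (H_grp p q F)"
  then have H: "mexp (t *\<^sub>R X) \<in> F" "mexp (t *\<^sub>R X) \<in> K0_grp p q" for t
    unfolding lie_algebra_def H_grp_def by blast+
  have commute: "X ** Z = Z ** X" if "Z = N2 p q \<or> Z = N2 q p" for Z
    using K0_grp_commutes[OF assms(1) that H(2)] by (rule mexp_commutes_imp_commutes)
  have commute1: "X ** N2 p q = N2 p q ** X"
    by (rule commute[OF disjI1[OF refl]])
  have commute2: "X ** N2 q p = N2 q p ** X"
    by (rule commute[OF disjI2[OF refl]])
  note block = commutes_N2_entries[OF commute1 commute2]
  have "F \<subseteq> SU_n1 p q"
    using F_subset_G_grp nonsymmetric_descriptionD(3)[OF assms(2)] by (rule subset_trans)
  then have "X \<in> lie_algebra (SU_n1 p q)"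
    using H(1) unfolding lie_algebra_def by blast
  note SU = lie_algebra_SU_n1[OF this]
  \<comment> \<open>Entry (i, j) of JX + X^* J = 0 with J the Gram matrix. Since J commutes with
    matrices diag(B, z, z), this becomes ordinary skewness.\<close>
  have skew: "X $ (if i = p then q else if i = q then p else i) $ j +
      cnj (X $ (if j = p then q else if j = q then p else j) $ i) = 0" for i j
    using SU(2)[of "axis j 1" "axis i 1"]
    unfolding hform_axis[OF assms(1)] matrix_vector_mult_axis_nth .
  have "cnj (X $ j $ i) = - X $ i $ j" for i j
  proof (cases "i \<in> {p, q} \<or> j \<in> {p, q}")
    case True
    have "X $ p $ p + cnj (X $ p $ p) = 0" using skew[of q p] assms(1) by (simp add: block(1))
    then have diag: "cnj (X $ p $ p) = - X $ p $ p" by (metis add.commute eq_neg_iff_add_eq_0)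
    show ?thesis
    proof (cases "i = j")
      case i: True
      then have "X $ i $ j = X $ p $ p" "X $ j $ i = X $ p $ p" using True block(1) by auto
      then show ?thesis using diag by (simp only:)
    next
      case False
      have "X $ i $ j = 0" "X $ j $ i = 0" using True False block(2-5) by (metis empty_iff insert_iff)+
      then show ?thesis by simp
    qed
  next
    case False
    then have "X $ i $ j + cnj (X $ j $ i) = 0" using skew[of i j] by simp
    then show ?thesis by (metis add.commute eq_neg_iff_add_eq_0)
  qed
  then show "X \<in> k0_alg p q"
    unfolding k0_alg_iff[OF assms(1)] using commute1 commute2 SU(1) by blast
qed

lemma subgroup_H_grp:
  assumes "nonsymmetric_description p q F"
  shows "subgroup (H_grp p q F) GL"
  unfolding H_grp_def
  by (rule group.subgroups_Inter_pair[OF group_GL nonsymmetric_descriptionD(1)[OF assms] subgroup_K0_grp])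

text \<open>As A contains the identity, K0 lies in the product of K0 and A; the closed set that cuts
  F out of this product then cuts H out of K0.\<close>

lemma closedin_H_grp:
  assumes "nonsymmetric_description p q F"
  shows "closedin (top_of_set (K0_grp p q)) (H_grp p q F)"
proof -
  have "mat 1 \<in> A_grp p q"
    unfolding A_grp_def using mexp_0 span_zero by (metis imageI)
  then have "K0_grp p q \<subseteq> K0_grp p q <#>\<^bsub>GL\<^esub> A_grp p q"
    unfolding set_mult_def GL_simps using matrix_mul_rid by fastforce
  moreover obtain C where "closed C" "F = (K0_grp p q <#>\<^bsub>GL\<^esub> A_grp p q) \<inter> C"
    using nonsymmetric_descriptionD(2)[OF assms] unfolding closedin_closed by blast
  ultimately show ?thesis
    unfolding closedin_closed H_grp_def by blast
qed

lemma subspace_lie_algebra_H_grp: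
  assumes "p \<noteq> q" "nonsymmetric_description p q F"
  shows "subspace (lie_algebra (H_grp p q F))"
  unfolding subspace_def
proof (intro conjI ballI allI)
  note H = subgroup_H_grp[OF assms(2)]
  show "0 \<in> lie_algebra (H_grp p q F)"
    using subgroup.one_closed[OF H] by (simp add: lie_algebra_def)
  fix X assume X: "X \<in> lie_algebra (H_grp p q F)"
  show "c *\<^sub>R X \<in> lie_algebra (H_grp p q F)" for c
    using X by (rule lie_algebra_scaleR)
  fix Y assume Y: "Y \<in> lie_algebra (H_grp p q F)"
  have "X + Y \<in> k0_alg p q"
    using X Y lie_algebra_H_grp[OF assms] subspace_add[OF subspace_k0_alg[OF assms(1)]] by blast
  then show "X + Y \<in> lie_algebra (H_grp p q F)"
    using lie_algebra_add[OF H closedin_H_grp[OF assms(2)] X Y] k0_alg_subset_lie_algebra[OF assms(1)]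
    by blast
qed

lemma bracket_lie_algebra_H_grp:
  assumes "p \<noteq> q" "nonsymmetric_description p q F"
    and "E \<in> lie_algebra (H_grp p q F)" "E' \<in> lie_algebra (H_grp p q F)"
  shows "bracket E E' \<in> lie_algebra (H_grp p q F)"
proof (rule bracket_in_subspace[OF subspace_lie_algebra_H_grp[OF assms(1,2)]])
  fix t
  have "mexp (t *\<^sub>R E) \<in> H_grp p q F" using assms(3) by (simp add: lie_algebra_def)
  from lie_algebra_conj[OF subgroup_H_grp[OF assms(2)] assms(4) this]
  show "mexp (t *\<^sub>R E) ** E' ** mexp (- t *\<^sub>R E) \<in> lie_algebra (H_grp p q F)" by simp
qed

text \<open>\<^term>\<open>Hr\<close> need not lie in the isotropy algebra itself, but \<^term>\<open>A0 p q\<close> centralizes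
  \<^term>\<open>k0_alg p q\<close>, so \<^term>\<open>Hr\<close> acts on the isotropy algebra as \<^term>\<open>A0 p q + Hr\<close> does.\<close>

lemma bracket_Hr_lie_algebra_H_grp:
  assumes "p \<noteq> q" "nonsymmetric_description p q F"
    and "Hr \<in> k0_alg p q" "A0 p q + Hr \<in> lie_algebra F" "E \<in> lie_algebra (H_grp p q F)"
  shows "bracket Hr E \<in> lie_algebra (H_grp p q F)"
proof -
  note k0 = lie_algebra_H_grp[OF assms(1,2)]
  have E: "E \<in> k0_alg p q" "E \<in> lie_algebra F"
    using assms(5) k0 by (auto simp: lie_algebra_def H_grp_def)
  have "bracket (A0 p q + Hr) E \<in> lie_algebra (H_grp p q F)"
  proof (rule bracket_in_subspace[OF subspace_lie_algebra_H_grp[OF assms(1,2)]])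
    fix t
    let ?A = "t *\<^sub>R A0 p q" and ?H = "t *\<^sub>R Hr"
    let ?C = "mexp (t *\<^sub>R (A0 p q + Hr)) ** E ** mexp (- (t *\<^sub>R (A0 p q + Hr)))"
    note F = nonsymmetric_descriptionD(1)[OF assms(2)]
    have "mexp (t *\<^sub>R (A0 p q + Hr)) \<in> F" using assms(4) by (simp add: lie_algebra_def)
    from lie_algebra_conj[OF F E(2) this] have CF: "?C \<in> lie_algebra F" .
    have com: "?A ** Z = Z ** ?A" if "Z \<in> k0_alg p q" for Z
      using bracket_A0_k0[OF assms(1) that]
      by (simp add: bracket_eq_0_iff scaleR_matrix_mult_left scaleR_matrix_mult_right)
    have H: "?H \<in> k0_alg p q" "- ?H \<in> k0_alg p q"
      using subspace_scale[OF subspace_k0_alg[OF assms(1)] assms(3)]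
        subspace_neg[OF subspace_k0_alg[OF assms(1)]] by blast+
    have 1: "mexp (t *\<^sub>R (A0 p q + Hr)) = mexp ?H ** mexp ?A"
      using mexp_add[OF com[OF H(1), symmetric]] by (simp add: scaleR_add_right add.commute)
    have "(- ?A) ** (- ?H) = (- ?H) ** (- ?A)"
      using com[OF H(1)] by (simp add: matrix_mult_minus_left matrix_mult_minus_right)
    from mexp_add[OF this] have 2: "mexp (- (t *\<^sub>R (A0 p q + Hr))) = mexp (- ?A) ** mexp (- ?H)"
      by (simp add: scaleR_add_right)
    have 3: "mexp ?A ** E = E ** mexp ?A"
      using com[OF E(1)] by (rule mexp_intertwine)
    have "?C = mexp ?H ** (mexp ?A ** E) ** mexp (- ?A) ** mexp (- ?H)"
      unfolding 1 2 by (simp add: matrix_mul_assoc)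
    also have "\<dots> = mexp ?H ** E ** (mexp ?A ** mexp (- ?A)) ** mexp (- ?H)"
      unfolding 3 by (simp add: matrix_mul_assoc)
    \<comment> \<open>The factor from A0 cancels because it commutes with \<open>E\<close>. What is
      left is conjugation by an element of K0, so the result lies in the Lie algebra of K0 as well
      as in that of F.\<close>
    finally have "?C = mexp ?H ** E ** mexp (- ?H)"
      by (simp add: mexp_minus_right)
    moreover have "mexp ?H ** E ** mexp (- ?H) \<in> lie_algebra (K0_grp p q)"
      by (rule lie_algebra_conj[OF subgroup_K0_grp k0_alg_subset_lie_algebra[OF assms(1) E(1)]
            mexp_in_k0_group[OF H(1)]])
    ultimately have "?C \<in> lie_algebra (K0_grp p q)" by simp
    with CF have "?C \<in> lie_algebra (H_grp p q F)"
      unfolding lie_algebra_def H_grp_def by blast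
    then show "mexp (t *\<^sub>R (A0 p q + Hr)) ** E ** mexp (- t *\<^sub>R (A0 p q + Hr)) \<in> lie_algebra (H_grp p q F)"
      by simp
  qed
  then show ?thesis
    using bracket_A0_k0[OF assms(1) E(1)] by (simp add: bracket_simps)
qed

section \<open>Reductive decompositions\<close>

lemma reductive_decomposition_bracket:
  assumes "reductive_decomposition G H \<mm>" "E \<in> lie_algebra H" "M \<in> \<mm>"
  shows "bracket E M \<in> \<mm>"
proof (rule bracket_in_subspace)
  show "subspace \<mm>" using assms(1) by (simp add: reductive_decomposition_def)
  fix t
  have "mexp (t *\<^sub>R E) \<in> H" using assms(2) by (simp add: lie_algebra_def)
  then have "mexp (t *\<^sub>R E) ** M ** matrix_inv (mexp (t *\<^sub>R E)) \<in> \<mm>"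
    using assms(1,3) unfolding reductive_decomposition_def by blast
  then show "mexp (t *\<^sub>R E) ** M ** mexp (- t *\<^sub>R E) \<in> \<mm>"
    by (simp add: matrix_inv_mexp)
qed

text \<open>The value is minus the h-component of \<open>Z\<close>, so \<open>Z\<close> plus it is
  the m-component; two candidates differ by an element of both h and m.\<close>

lemma reductive_decomposition_phi_r:
  assumes red: "reductive_decomposition G H \<mm>" and "subspace (lie_algebra H)" "Z \<in> lie_algebra G"
  shows "phi_r (lie_algebra H) \<mm> Z \<in> lie_algebra H" "Z + phi_r (lie_algebra H) \<mm> Z \<in> \<mm>"
proof -
  have \<mm>: "subspace \<mm>" "lie_algebra H \<inter> \<mm> = {0}"
    using red by (simp_all add: reductive_decomposition_def)
  obtain E M where EM: "Z = E + M" "E \<in> lie_algebra H" "M \<in> \<mm>"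
    using assms(3) red unfolding reductive_decomposition_def by blast
  have "\<exists>!E. E \<in> lie_algebra H \<and> Z + E \<in> \<mm>"
  proof (rule ex1I[of _ "- E"])
    show "- E \<in> lie_algebra H \<and> Z + - E \<in> \<mm>"
      using EM subspace_neg[OF assms(2)] by simp
    fix E' assume E': "E' \<in> lie_algebra H \<and> Z + E' \<in> \<mm>"
    have "E' + E \<in> lie_algebra H" using E' EM(2) subspace_add[OF assms(2)] by blast
    moreover have "E' + E = (Z + E') - M" using EM(1) by simp
    then have "E' + E \<in> \<mm>" using E' EM(3) subspace_diff[OF \<mm>(1)] by metis
    ultimately have "E' + E = 0" using \<mm>(2) by blast
    then show "E' = - E" by (simp add: eq_neg_iff_add_eq_0)
  qed
  from theI'[OF this]
  show "phi_r (lie_algebra H) \<mm> Z \<in> lie_algebra H" "Z + phi_r (lie_algebra H) \<mm> Z \<in> \<mm>"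
    unfolding phi_r_def by blast+
qed

text \<open>Removes the definite description: it suffices to guess \<open>M\<close> in m and check
  that the bracket differs from it by an element of h.\<close>

lemma torsion_eqI:
  assumes red: "reductive_decomposition G H \<mm>" and h: "subspace (lie_algebra H)"
    and M: "M \<in> \<mm>" "bracket B C - M \<in> lie_algebra H"
  shows "torsion (lie_algebra H) \<mm> B C = - M"
proof -
  have \<mm>: "subspace \<mm>" "lie_algebra H \<inter> \<mm> = {0}"
    using red by (simp_all add: reductive_decomposition_def)
  have "m_part (lie_algebra H) \<mm> (bracket B C) = M"
    unfolding m_part_def
  proof (rule the_equality)
    fix M' assume M': "M' \<in> \<mm> \<and> bracket B C - M' \<in> lie_algebra H"
    have "M' - M = (bracket B C - M) - (bracket B C - M')" by simp
    then have "M' - M \<in> lie_algebra H" using subspace_diff[OF h] M(2) M' by metis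
    moreover have "M' - M \<in> \<mm>" using subspace_diff[OF \<mm>(1)] M(1) M' by blast
    ultimately have "M' - M = 0" using \<mm>(2) by blast
    then show "M' = M" by simp
  qed (use M in simp)
  then show ?thesis by (simp add: torsion_def)
qed

theorem corollary3p3:
  fixes p q :: "'k::finite"
    and F \<mm> :: "'k cmat set"
    and Hr :: "'k cmat"
  defines "\<hh> \<equiv> lie_algebra (H_grp p q F)"
  defines "\<phi> \<equiv> phi p q \<hh> \<mm> Hr"
    and "td \<equiv> tilde p q \<hh> \<mm> Hr"
    and "T \<equiv> torsion \<hh> \<mm>"
  defines "f \<equiv> \<lambda>X. X + bracket (Hr + \<phi> (A0 p q)) X"
  assumes "p \<noteq> q"
    and "nonsymmetric_description p q F"
    and "Hr \<in> k0_alg p q" and "a_r p q F = span {A0 p q + Hr}"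
    and "reductive_decomposition (G_grp p q F) (H_grp p q F) \<mm>"
    and "X \<in> n1_alg p q" and "Y \<in> n1_alg p q"
  shows "f X \<in> n1_alg p q \<and>
         T (td (A0 p q)) (td X) = - td (f X) \<and>
         T (td (A0 p q)) (td (N2 p q)) = - 2 *\<^sub>R td (N2 p q) \<and>
         T (td (N2 p q)) (td X) = - bracket (\<phi> (N2 p q)) X \<and>
         T (td X) (td Y) =
           - (2 * omega0 p q X Y) *\<^sub>R td (N2 p q) - bracket (\<phi> X) (td Y) - bracket (td X) (\<phi> Y)"
proof -
  note pq = \<open>p \<noteq> q\<close> and desc = \<open>nonsymmetric_description p q F\<close> and Hr = \<open>Hr \<in> k0_alg p q\<close>
  note red = \<open>reductive_decomposition (G_grp p q F) (H_grp p q F) \<mm>\<close>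
  note X = \<open>X \<in> n1_alg p q\<close> and Y = \<open>Y \<in> n1_alg p q\<close>
  let ?A = "A0 p q" and ?N = "N2 p q"
  note F = nonsymmetric_descriptionD(1)[OF desc]
  have Ar: "?A + Hr \<in> lie_algebra F"
    using \<open>a_r p q F = span {?A + Hr}\<close> span_base[of "?A + Hr" "{?A + Hr}"]
    unfolding a_r_def by blast
  have h: "subspace \<hh>" unfolding \<hh>_def by (rule subspace_lie_algebra_H_grp[OF pq desc])
  have m: "subspace \<mm>" "\<hh> \<inter> \<mm> = {0}"
    using red by (simp_all add: reductive_decomposition_def \<hh>_def)
  have hk: "E \<in> k0_alg p q" if "E \<in> \<hh>" for E
    using that lie_algebra_H_grp[OF pq desc] unfolding \<hh>_def by blast
  have hh: "bracket E E' \<in> \<hh>" if "E \<in> \<hh>" "E' \<in> \<hh>" for E E'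
    using that bracket_lie_algebra_H_grp[OF pq desc] unfolding \<hh>_def by blast
  have hm: "bracket E M \<in> \<mm>" if "E \<in> \<hh>" "M \<in> \<mm>" for E M
    using that reductive_decomposition_bracket[OF red] unfolding \<hh>_def by blast

  have n1_G: "Z \<in> lie_algebra (G_grp p q F)" if "Z \<in> n1_alg p q" for Z
    using n_alg_subset_lie_algebra[OF F pq that, of 0] by simp
  have N_G: "?N \<in> lie_algebra (G_grp p q F)"
    using n_alg_subset_lie_algebra[OF F pq subspace_0[OF subspace_n1_alg[OF pq]], of 1] by simp
  have A_G: "?A + Hr \<in> lie_algebra (G_grp p q F)"
    using Ar F_subset_G_grp[of F p q] unfolding lie_algebra_def by blast
  have chi_n1: "chi_r p q Hr Z = Z" if "Z \<in> n1_alg p q" for Z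
  proof -
    have "Z \<in> n_alg p q"
      unfolding n_alg_def using that
      by (intro CollectI exI[of _ Z] exI[of _ 0]) (simp add: span_zero)
    then show ?thesis by (rule chi_r_characterization(2)[OF pq])
  qed
  have chi_N: "chi_r p q Hr ?N = ?N"
    using pq by (simp add: chi_r_def N2_def)
  note chi_A = chi_r_characterization(3)[OF pq, of Hr]

  have phi: "\<phi> Z \<in> \<hh>" "td Z \<in> \<mm>" if "chi_r p q Hr Z \<in> lie_algebra (G_grp p q F)" for Z
    using reductive_decomposition_phi_r[OF red h[unfolded \<hh>_def] that]
    unfolding \<phi>_def td_def tilde_def phi_def \<hh>_def by simp_all
  have phi_n1: "\<phi> Z \<in> \<hh>" "td Z \<in> \<mm>" "td Z = Z + \<phi> Z" if "Z \<in> n1_alg p q" for Z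
    using phi[of Z] n1_G[OF that] unfolding td_def tilde_def \<phi>_def chi_n1[OF that] by simp_all
  have phi_N: "\<phi> ?N \<in> \<hh>" "td ?N \<in> \<mm>" "td ?N = ?N + \<phi> ?N"
    using phi[of ?N] N_G unfolding td_def tilde_def \<phi>_def chi_N by simp_all
  have phi_A: "\<phi> ?A \<in> \<hh>" "td ?A \<in> \<mm>" "td ?A = ?A + (Hr + \<phi> ?A)"
    using phi[of ?A] A_G unfolding td_def tilde_def \<phi>_def chi_A by (simp_all add: add.assoc)
  \<comment> \<open>This is the isotropy correction to A0 in \<open>td ?A\<close>. Lying in k0, it
    preserves n1 and kills \<open>?N\<close>; that it also normalizes h is a separate fact, since it
    need not belong to h.\<close>
  define H0 where "H0 = Hr + \<phi> ?A"
  have H0: "H0 \<in> k0_alg p q"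
    unfolding H0_def using Hr hk[OF phi_A(1)] by (rule subspace_add[OF subspace_k0_alg[OF pq]])
  have H0h: "bracket H0 E \<in> \<hh>" if "E \<in> \<hh>" for E
  proof -
    have "bracket Hr E \<in> \<hh>"
      using bracket_Hr_lie_algebra_H_grp[OF pq desc Hr Ar] that unfolding \<hh>_def by blast
    then show ?thesis
      unfolding H0_def bracket_simps using hh[OF phi_A(1) that] by (rule subspace_add[OF h])
  qed
  have AE: "bracket ?A E = 0" if "E \<in> \<hh>" for E
    using bracket_A0_k0[OF pq hk[OF that]] .
  have EN: "bracket E ?N = 0" if "E \<in> k0_alg p q" for E
    using bracket_N2_k0[OF pq that] .
  have NE: "bracket ?N E = 0" if "E \<in> k0_alg p q" for E
    using EN[OF that] bracket_skew[of ?N E] by simp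
  have AX: "bracket ?A Z = Z" if "Z \<in> n1_alg p q" for Z
    using that n1_alg_iff[OF pq] by blast
  have T: "T B C = - M" if "M \<in> \<mm>" "bracket B C - M \<in> \<hh>" for B C M
    using torsion_eqI[OF red h[unfolded \<hh>_def]] that unfolding T_def \<hh>_def by blast

  have central: "bracket E (\<phi> ?N) = 0" if "E \<in> \<hh>" for E
  proof -
    \<comment> \<open>\<open>E\<close> annihilates \<open>?N\<close>, so its action on the element
      \<open>td ?N\<close> of m is its action on the element \<open>\<phi> ?N\<close> of h.\<close>
    have "bracket E (td ?N) = bracket E (\<phi> ?N)"
      by (simp add: phi_N(3) bracket_simps EN[OF hk[OF that]])
    then have "bracket E (\<phi> ?N) \<in> \<mm>" using hm[OF that phi_N(2)] by simp
    then show ?thesis using hh[OF that phi_N(1)] m(2) by blast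
  qed

  have fX: "f X \<in> n1_alg p q"
    unfolding f_def H0_def[symmetric]
    using X bracket_k0_n1[OF pq H0 X] by (rule subspace_add[OF subspace_n1_alg[OF pq]])
  moreover have "T (td ?A) (td X) = - td (f X)"
  proof (rule T[OF phi_n1(2)[OF fX]])
    \<comment> \<open>A0 acts as the identity on \<open>X\<close> and as zero on
      \<open>\<phi> X\<close>. The remaining \<open>bracket H0 X\<close> completes
      \<open>f X\<close>; passing from \<open>f X\<close> to \<open>td (f X)\<close> costs only an
      element of h.\<close>
    have "bracket (td ?A) (td X) = f X + bracket H0 (\<phi> X)"
      by (simp add: phi_A(3) phi_n1(3)[OF X] bracket_simps AX[OF X] AE[OF phi_n1(1)[OF X]]
          f_def H0_def)
    then have "bracket (td ?A) (td X) - td (f X) = bracket H0 (\<phi> X) - \<phi> (f X)"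
      by (simp add: phi_n1(3)[OF fX])
    then show "bracket (td ?A) (td X) - td (f X) \<in> \<hh>"
      using subspace_diff[OF h H0h[OF phi_n1(1)[OF X]] phi_n1(1)[OF fX]] by simp
  qed
  moreover have "T (td ?A) (td ?N) = - (2 *\<^sub>R td ?N)"
  proof (rule T[OF subspace_scale[OF m(1) phi_N(2)]])
    have "bracket (td ?A) (td ?N) - 2 *\<^sub>R td ?N = bracket H0 (\<phi> ?N) - 2 *\<^sub>R \<phi> ?N"
      unfolding phi_A(3) phi_N(3) H0_def[symmetric] bracket_simps
        bracket_A0_N2[OF pq] AE[OF phi_N(1)] EN[OF H0]
      by (simp add: algebra_simps)
    then show "bracket (td ?A) (td ?N) - 2 *\<^sub>R td ?N \<in> \<hh>"
      using subspace_diff[OF h H0h[OF phi_N(1)] subspace_scale[OF h phi_N(1)]] by simp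
  qed
  moreover have "T (td ?N) (td X) = - bracket (\<phi> ?N) X"
  proof (rule T)
    \<comment> \<open>With this term gone, \<open>bracket (\<phi> ?N) X\<close> is a bracket of h
      with m, hence in m, and equals the whole bracket of \<open>td ?N\<close> and
      \<open>td X\<close>.\<close>
    have NX: "bracket (\<phi> ?N) (\<phi> X) = 0"
      using central[OF phi_n1(1)[OF X]] bracket_skew[of "\<phi> ?N" "\<phi> X"] by simp
    then have "bracket (\<phi> ?N) (td X) = bracket (\<phi> ?N) X"
      by (simp add: phi_n1(3)[OF X] bracket_simps)
    then show "bracket (\<phi> ?N) X \<in> \<mm>" using hm[OF phi_N(1) phi_n1(2)[OF X]] by simp
    have "bracket (td ?N) (td X) - bracket (\<phi> ?N) X = 0"
      unfolding phi_N(3) phi_n1(3)[OF X] bracket_simps NX NE[OF hk[OF phi_n1(1)[OF X]]]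
        bracket_N2_n1[OF pq X] by simp
    then show "bracket (td ?N) (td X) - bracket (\<phi> ?N) X \<in> \<hh>" using subspace_0[OF h] by simp
  qed
  moreover have "T (td X) (td Y) =
      - ((2 * omega0 p q X Y) *\<^sub>R td ?N + bracket (\<phi> X) (td Y) - bracket (\<phi> Y) (td X))"
  proof (rule T)
    let ?c = "2 * omega0 p q X Y"
    note pX = phi_n1[OF X] and pY = phi_n1[OF Y]
    show "?c *\<^sub>R td ?N + bracket (\<phi> X) (td Y) - bracket (\<phi> Y) (td X) \<in> \<mm>"
      using phi_N(2) hm[OF pX(1) pY(2)] hm[OF pY(1) pX(2)] m(1)
      by (intro subspace_add subspace_diff subspace_scale)
    \<comment> \<open>The two mixed brackets in the candidate contain
      \<open>bracket (\<phi> X) (\<phi> Y)\<close> twice, the full bracket only once. This surplus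
      and the multiple of \<open>\<phi> ?N\<close> inside \<open>td ?N\<close> are all that
      remains.\<close>
    have "bracket (td X) (td Y) - (?c *\<^sub>R td ?N + bracket (\<phi> X) (td Y) - bracket (\<phi> Y) (td X)) =
        - (?c *\<^sub>R \<phi> ?N) + bracket (\<phi> Y) (\<phi> X)"
      unfolding phi_N(3) pX(3) pY(3) bracket_simps bracket_n1_n1[OF pq X Y]
        bracket_skew[of X "\<phi> Y"]
      by (simp add: algebra_simps)
    then show "bracket (td X) (td Y) -
        (?c *\<^sub>R td ?N + bracket (\<phi> X) (td Y) - bracket (\<phi> Y) (td X)) \<in> \<hh>"
      using subspace_add[OF h subspace_neg[OF h subspace_scale[OF h phi_N(1)]] hh[OF pY(1) pX(1)]]
      by simp
  qed
  ultimately show ?thesis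
    using bracket_skew[of "td X" "\<phi> Y"] by simp
qed

end
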